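(* There exist absolute constants $0<c_3<c_4$ such that the following holds. For each $n$ let $N=n(n-1)/2$ and let $F=F_n$ be a distribution on the positive orthant $\mathbb{R}_+^N$, with one coordinate for each pair $e=ij$, $1\le i<j\le n$, having a down-monotone logconcave density. Let $X$ be a random point from $F$, let $\sigma_e^2=\mathbb{E}(X_e^2)$ for every coordinate $e$, and let $\sigma_{\min}=\min_e\sigma_e$ and $\sigma_{\max}=\max_e\sigma_e$. Then, for $p=p(n)$, $$\lim_{\substack{n\to\infty\\ n\text{ even}}}\Pr(G_{F,p}\text{ has a perfect matching})=\begin{cases}0 & \text{if } p<\dfrac{c_3\sigma_{\min}}{n},\\[2mm] 1 & \text{if } p>\dfrac{c_4\sigma_{\max}\ln n}{n}.\end{cases}$$
   Context: A function $f:\mathbb{R}^m\to\mathbb{R}_+$ is logconcave if $f(\lambda x+(1-\lambda)y)\ge f(x)^{\lambda}f(y)^{1-\lambda}$ for all $x,y\in\mathbb{R}^m$ and $\lambda\in[0,1]$. A density $f$ supported in the positive orthant $\mathbb{R}_+^m$ is down-monotone if $f(x)\ge f(y)$ for all $x,y\in\mathbb{R}_+^m$ with $x\le y$ coordinatewise. Given a distribution $F$ on $\mathbb{R}_+^N$, $N=n(n-1)/2$, with a coordinate for each pair of vertices in $[n]=\{1,\dots,n\}$, the random graph $G_{F,p}$ has vertex set $[n]$ and is obtained by picking a random point $X$ from $F$ and taking as edges all pairs $ij$ with $X_{ij}\le p$. *)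

theory Defs
  imports "HOL-Probability.Probability" "HOL-Library.Ramsey"
begin

text \<open>For a finite index set \<open>I\<close>, the space \<open>\<real>\<^sup>I\<close> is \<open>I \<rightarrow>\<^sub>E UNIV\<close>, its positive orthant is
  \<open>I \<rightarrow>\<^sub>E {0..}\<close>, and Lebesgue measure on it is the product measure \<open>\<Pi>\<^sub>M e\<in>I. lborel\<close>.\<close>

abbreviation rspace :: "'i set \<Rightarrow> ('i \<Rightarrow> real) set"
  where "rspace I \<equiv> I \<rightarrow>\<^sub>E UNIV"

abbreviation orthant :: "'i set \<Rightarrow> ('i \<Rightarrow> real) set"
  where "orthant I \<equiv> I \<rightarrow>\<^sub>E {0..}"

text \<open>In HOL \<open>0 powr 0 = 0\<close> instead of \<open>1\<close>. This only matters for \<open>l \<in> {0, 1}\<close>,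
  where the inequality holds trivially under either convention.\<close>

definition logconcave :: "'i set \<Rightarrow> (('i \<Rightarrow> real) \<Rightarrow> real) \<Rightarrow> bool"
  where "logconcave I f \<longleftrightarrow>
    (\<forall>x\<in>rspace I. 0 \<le> f x) \<and>
    (\<forall>x\<in>rspace I. \<forall>y\<in>rspace I. \<forall>l\<in>{0..1}.
      f x powr l * f y powr (1 - l) \<le> f (\<lambda>e\<in>I. l * x e + (1 - l) * y e))"

definition supported_in_orthant :: "'i set \<Rightarrow> (('i \<Rightarrow> real) \<Rightarrow> real) \<Rightarrow> bool"
  where "supported_in_orthant I f \<longleftrightarrow> (\<forall>x\<in>rspace I - orthant I. f x = 0)"

definition down_monotone :: "'i set \<Rightarrow> (('i \<Rightarrow> real) \<Rightarrow> real) \<Rightarrow> bool"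
  where "down_monotone I f \<longleftrightarrow>
    (\<forall>x\<in>orthant I. \<forall>y\<in>orthant I. (\<forall>e\<in>I. x e \<le> y e) \<longrightarrow> f y \<le> f x)"

definition down_monotone_logconcave_distribution :: "'i set \<Rightarrow> ('i \<Rightarrow> real) measure \<Rightarrow> bool"
  where "down_monotone_logconcave_distribution I F \<longleftrightarrow>
    prob_space F \<and>
    (\<exists>f. f \<in> borel_measurable (\<Pi>\<^sub>M e\<in>I. lborel) \<and>
         logconcave I f \<and> supported_in_orthant I f \<and> down_monotone I f \<and>
         F = density (\<Pi>\<^sub>M e\<in>I. lborel) (\<lambda>x. ennreal (f x)))"

text \<open>The coordinates are indexed by the two-element subsets of \<open>{1..n}\<close>.\<close>

abbreviation vertex_pairs :: "nat \<Rightarrow> nat set set"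
  where "vertex_pairs n \<equiv> [{1..n}]\<^bsup>2\<^esup>"

lemma card_vertex_pairs: "card (vertex_pairs n) = n * (n - 1) div 2"
  using n_subsets[of "{1..n}" 2] finite_subset[of _ "{1..n}"]
  by (simp add: nsets_def choose_two cong: conj_cong)

text \<open>A graph is a pair of a vertex set and a set of two-element edges.\<close>

type_synonym 'v graph = "'v set \<times> 'v set set"

definition threshold_graph :: "nat \<Rightarrow> real \<Rightarrow> (nat set \<Rightarrow> real) \<Rightarrow> nat graph"
  where "threshold_graph n p x = ({1..n}, {e \<in> vertex_pairs n. x e \<le> p})"

definition perfect_matching :: "'v graph \<Rightarrow> 'v set set \<Rightarrow> bool"
  where "perfect_matching G M \<longleftrightarrow> M \<subseteq> snd G \<and> disjoint M \<and> \<Union>M = fst G"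

definition has_perfect_matching :: "'v graph \<Rightarrow> bool"
  where "has_perfect_matching G \<longleftrightarrow> (\<exists>M. perfect_matching G M)"

definition prob_perfect_matching :: "nat \<Rightarrow> (nat set \<Rightarrow> real) measure \<Rightarrow> real \<Rightarrow> real"
  where "prob_perfect_matching n F p =
    measure F {x \<in> space F. has_perfect_matching (threshold_graph n p x)}"

definition coord_sigma :: "('i \<Rightarrow> real) measure \<Rightarrow> 'i \<Rightarrow> real"
  where "coord_sigma F e = sqrt (\<integral>x. (x e)\<^sup>2 \<partial>F)"

definition sigma_min :: "nat \<Rightarrow> (nat set \<Rightarrow> real) measure \<Rightarrow> real"
  where "sigma_min n F = Min (coord_sigma F ` vertex_pairs n)"

definition sigma_max :: "nat \<Rightarrow> (nat set \<Rightarrow> real) measure \<Rightarrow> real"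
  where "sigma_max n F = Max (coord_sigma F ` vertex_pairs n)"

text \<open>The filter of \<open>n \<rightarrow> \<infinity>\<close> along even \<open>n\<close>.\<close>

definition even_at_top :: "nat filter"
  where "even_at_top = inf at_top (principal {n. even n})"

end

(* Take logconcavity in the midpoint form f x * f y <= (f ((x + y) / 2))^2. A Prekopa-Leindler inequality
   for decreasing functions on the orthant (where the superlevel sets in one dimension are initial
   segments) shows that marginals inherit it and that T(t) = P(X_e >= t for all e in A) satisfies
   T(2t) <= T(t)^2.

   Upper bound for P(X_e <= p for all e in S): comparing f(x) with f(x/2) shows that the density g of
   X_S is at least 16^(-2) 4^(-|S|) g(0) outside a set of probability 1/16. The superlevel set is convex
   and down-closed, so it contains a box with sides comparable to the sigma_e; hence
   g(0) <= C^|S| / prod sigma_e. A union bound over the sets of n/2 pairs gives the limit 0.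

   Upper bound for P(X_e >= p for all e in A): T(p) <= T(p/2^j)^(2^j), and as j tends to infinity the
   right-hand side is governed by the densities of the X_e at 0, which are at least 1/(4 sigma_e).
   If the graph has no perfect matching, then Hall's theorem for the two halves of the vertex set gives
   sets S, T with |S| + |T| = n/2 + 1 without an edge between them; a union bound gives the limit 1. *)

theory Submission
  imports Defs
begin

section \<open>The Prekopa-Leindler inequality for decreasing functions\<close>

text \<open>The coordinates are dependent, so both union bounds need joint estimates that are
  exponential in the number of coordinates involved. For small values the crux is one point where
  all coordinates are large at once and the density is still high. The one-dimensional tails give
  such points for each coordinate separately, and a union bound over the coordinates would lose a
  factor growing with their number; an averaging argument over a set of probability at least 15/16
  supplies the point, using only midpoints. For large values, inclusion-exclusion at level t has an
  error of order t^2, controlled by the two-coordinate case of the small-value estimate. Its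
  constant depends on the distribution, but the error dies out when the tail at t = p/2^j is raised
  to the power 2^j. The constants are c_3 = 1/(512 * 12), where 512 belongs to the box estimate and
  12 beats the number of sets of pairs, and c_4 = 4 * 16, where 4 belongs to the densities at 0 and
  16 makes the exponential outweigh the binomial coefficients.\<close>

lemma ennreal_mult_le_square_of_add_le:
  fixes a b c :: ennreal
  assumes "a + b \<le> 2 * c"
  shows "a * b \<le> c\<^sup>2"
proof (cases "c = \<top>")
  case True
  then show ?thesis by (simp add: power2_eq_square)
next
  case False
  then have "2 * c < \<top>"
    by (simp add: ennreal_mult_less_top less_top)
  with assms have "a + b < \<top>" by (rule le_less_trans)
  then have "a < \<top>" "b < \<top>" by simp_all
  with False obtain x y z where a: "a = ennreal x" "0 \<le> x" and b: "b = ennreal y" "0 \<le> y"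
    and c: "c = ennreal z" "0 \<le> z"
    by (metis ennreal_cases less_irrefl)
  have "ennreal (x + y) \<le> ennreal (2 * z)"
    using assms by (simp add: a b c ennreal_mult)
  then have "x + y \<le> 2 * z" using c by (simp add: ennreal_le_iff)
  then have "(x + y)\<^sup>2 \<le> (2 * z)\<^sup>2"
    using a b by (intro power_mono) auto
  then have "x * y \<le> z\<^sup>2"
    using sum_squares_ge_zero[of "x - y" 0] by (simp add: power2_eq_square algebra_simps)
  then show ?thesis
    by (simp add: a b c ennreal_mult[symmetric] ennreal_power ennreal_leI)
qed

lemma ennreal_mult_strict_mono:
  fixes a b c d :: ennreal
  assumes "a < c" "b < d"
  shows "a * b < c * d"
proof -
  have "0 < c" "0 < d" using assms by (auto intro: le_less_trans[OF zero_le])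
  obtain x y where x: "a = ennreal x" "0 \<le> x" and y: "b = ennreal y" "0 \<le> y"
    using assms by (cases a; cases b) auto
  show ?thesis
  proof (cases "c = \<top> \<or> d = \<top>")
    case True
    then have "c * d = \<top>" using \<open>0 < c\<close> \<open>0 < d\<close> by (auto simp: ennreal_mult_eq_top_iff)
    then show ?thesis using x y by (simp add: ennreal_mult[symmetric])
  next
    case False
    then obtain z w where "c = ennreal z" "0 \<le> z" "d = ennreal w" "0 \<le> w"
      by (cases c; cases d) auto
    with assms x y show ?thesis
      by (auto simp: ennreal_mult[symmetric] ennreal_less_iff intro: mult_strict_mono)
  qed
qed

lemma power2_le_imp_le_ennreal: "a\<^sup>2 \<le> b\<^sup>2 \<Longrightarrow> a \<le> (b :: ennreal)"
  using ennreal_mult_strict_mono[of b a b a] by (metis leD leI power2_eq_square)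

text \<open>Fubini for the region below the graph of \<open>h\<close>, cut off at height
  \<open>c\<close>. Writing the levels as \<open>c * t\<close> with t in (0,1) lets functions with
  different maxima be compared level by level over the same interval.\<close>

lemma nn_integral_layer_cake:
  fixes h :: "real \<Rightarrow> ennreal"
  assumes h[measurable]: "h \<in> borel_measurable borel" and c: "0 < c"
  shows "(\<integral>\<^sup>+x. min (h x) (ennreal c) \<partial>lborel) =
    ennreal c * (\<integral>\<^sup>+t. emeasure lborel {x. ennreal (c * t) < h x} * indicator {0<..<1} t \<partial>lborel)"
proof -
  have inner: "(\<integral>\<^sup>+t. indicator {t. 0 < t \<and> t < 1 \<and> ennreal (c * t) < h x} t \<partial>lborel)
      = min (h x) (ennreal c) / ennreal c" for x
  proof (cases "h x \<ge> ennreal c")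
    case True
    have "{t. 0 < t \<and> t < 1 \<and> ennreal (c * t) < h x} = {0<..<1}"
    proof (auto)
      fix t :: real assume "0 < t" "t < 1"
      then have "ennreal (c * t) < ennreal c" using c by (intro ennreal_lessI) auto
      then show "ennreal (c * t) < h x" using True by simp
    qed
    then show ?thesis using True c by (simp add: min_absorb2 ennreal_divide_self)
  next
    case False
    then obtain r where r: "h x = ennreal r" "0 \<le> r" "r < c"
      by (cases "h x") (auto simp: ennreal_le_iff2 not_le)
    have "{t. 0 < t \<and> t < 1 \<and> ennreal (c * t) < h x} = {0<..<r / c}"
      using r c by (auto simp: ennreal_less_iff pos_less_divide_eq mult.commute
          intro: less_trans[of _ "r / c" 1])
    then show ?thesis using r c
      by (simp add: min_absorb1 ennreal_leI divide_ennreal)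
  qed
  have "(\<integral>\<^sup>+t. emeasure lborel {x. ennreal (c * t) < h x} * indicator {0<..<1} t \<partial>lborel)
     = (\<integral>\<^sup>+t. (\<integral>\<^sup>+x. indicator {t. 0 < t \<and> t < 1 \<and> ennreal (c * t) < h x} t \<partial>lborel) \<partial>lborel)"
  proof (intro nn_integral_cong)
    fix t :: real
    have "(\<integral>\<^sup>+x. indicator {t. 0 < t \<and> t < 1 \<and> ennreal (c * t) < h x} t \<partial>lborel)
       = (\<integral>\<^sup>+x. indicator {x. ennreal (c * t) < h x} x * indicator {0<..<1} t \<partial>lborel)"
      by (intro nn_integral_cong) (auto simp: indicator_def)
    also have "\<dots> = emeasure lborel {x. ennreal (c * t) < h x} * indicator {0<..<1} t"
      by (subst nn_integral_multc) auto
    finally show "emeasure lborel {x. ennreal (c * t) < h x} * indicator {0<..<1} t = 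
      (\<integral>\<^sup>+x. indicator {t. 0 < t \<and> t < 1 \<and> ennreal (c * t) < h x} t \<partial>lborel)" by simp
  qed
  also have "\<dots> = (\<integral>\<^sup>+x. (\<integral>\<^sup>+t. indicator {t. 0 < t \<and> t < 1 \<and> ennreal (c * t) < h x} t \<partial>lborel) \<partial>lborel)"
    by (rule lborel_pair.Fubini') simp
  also have "\<dots> = (\<integral>\<^sup>+x. min (h x) (ennreal c) / ennreal c \<partial>lborel)"
    by (simp only: inner)
  also have "\<dots> = (\<integral>\<^sup>+x. min (h x) (ennreal c) \<partial>lborel) / ennreal c"
    by (rule nn_integral_divide) simp
  finally show ?thesis
    using c by (simp add: ennreal_mult_divide_eq mult.commute[of "ennreal c"] ennreal_divide_times)
qed

text \<open>Brunn-Minkowski on the line. Since \<open>C\<close> is an initial segment, a midpoint in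
  it brings the whole interval from 0 along, so x + y \<le> 2|C| for all x in \<open>A\<close> and y
  in \<open>B\<close>; and a set of nonnegative reals has length at most its supremum.\<close>

lemma emeasure_initial_segment_midpoint:
  fixes A B C :: "real set"
  assumes [measurable]: "A \<in> sets borel" "B \<in> sets borel" "C \<in> sets borel"
    and A: "A \<subseteq> {0..}" "A \<noteq> {}" and B: "B \<subseteq> {0..}" "B \<noteq> {}"
    and C: "\<And>x y. 0 \<le> x \<Longrightarrow> x \<le> y \<Longrightarrow> y \<in> C \<Longrightarrow> x \<in> C"
    and mid: "\<And>x y. x \<in> A \<Longrightarrow> y \<in> B \<Longrightarrow> (x + y) / 2 \<in> C"
  shows "emeasure lborel A + emeasure lborel B \<le> 2 * emeasure lborel C"
proof (cases "emeasure lborel C = \<top>")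
  case True
  then show ?thesis by (simp add: ennreal_mult_top)
next
  case False
  then obtain c where c: "emeasure lborel C = ennreal c" "0 \<le> c"
    by (cases "emeasure lborel C") auto
  have sum_le: "x + y \<le> 2 * c" if "x \<in> A" "y \<in> B" for x y
  proof -
    have "{0..(x + y) / 2} \<subseteq> C" using C[OF _ _ mid[OF that]] by auto
    then have "emeasure lborel {0..(x + y) / 2} \<le> emeasure lborel C"
      by (intro emeasure_mono) auto
    then show ?thesis using c that A B by (auto simp: ennreal_le_iff)
  qed
  have le_of_subset: "emeasure lborel D \<le> ennreal r"
    if "D \<subseteq> {0..}" "D \<noteq> {}" "\<And>x. x \<in> D \<Longrightarrow> x \<le> r" for D :: "real set" and r
  proof -
    have "0 \<le> r" using that by fastforce
    moreover have "D \<subseteq> {0..r}" using that by auto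
    then have "emeasure lborel D \<le> emeasure lborel {0..r}" by (intro emeasure_mono) auto
    ultimately show ?thesis by simp
  qed
  have a: "emeasure lborel A \<le> ennreal (2 * c - y)" if "y \<in> B" for y
    using A sum_le[OF _ that] by (intro le_of_subset) (auto simp: algebra_simps)
  obtain y0 where y0: "y0 \<in> B" using B by auto
  have "emeasure lborel A < \<top>" using a[OF y0] by (rule le_less_trans) simp
  then obtain a' where a': "emeasure lborel A = ennreal a'" "0 \<le> a'"
    by (cases "emeasure lborel A") auto
  \<comment> \<open>By \<open>a\<close>, the length a' of \<open>A\<close> is at most 2c - y for
    each y in \<open>B\<close>, so 2c - a' is an upper bound of \<open>B\<close>.\<close>
  have "emeasure lborel B \<le> ennreal (2 * c - a')"
  proof (intro le_of_subset)
    fix y assume y: "y \<in> B"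
    obtain x where "x \<in> A" using A by auto
    then have "0 \<le> 2 * c - y" using sum_le[OF _ y, of x] A by auto
    then show "y \<le> 2 * c - a'" using a[OF y] a' by (simp add: ennreal_le_iff)
  qed (use B in auto)
  then have "emeasure lborel A + emeasure lborel B \<le> ennreal a' + ennreal (2 * c - a')"
    using a' by (intro add_mono) auto
  also have "a' \<le> 2 * c"
    using a[OF y0] a' B y0 sum_le[OF _ y0] A by (smt (verit) atLeast_iff ennreal_le_iff subset_iff ex_in_conv)
  then have "ennreal a' + ennreal (2 * c - a') = 2 * emeasure lborel C"
    using a' c by (simp flip: ennreal_plus add: ennreal_mult)
  finally show ?thesis .
qed

text \<open>The superlevel sets \<open>{u > \<alpha>t}\<close> and \<open>{v > \<beta>t}\<close> with \<open>\<alpha> = u 0\<close>, \<open>\<beta> = v 0\<close> are nonempty for \<open>0 < t < 1\<close>,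
  and their midpoints lie in \<open>{w > sqrt (\<alpha>\<beta>) t}\<close>; integrate the inequality of lengths over \<open>t\<close>.\<close>

lemma prekopa_leindler_real_finite:
  fixes u v w :: "real \<Rightarrow> ennreal"
  assumes [measurable]: "u \<in> borel_measurable borel" "v \<in> borel_measurable borel" "w \<in> borel_measurable borel"
    and zero: "\<And>x. x < 0 \<Longrightarrow> u x = 0" "\<And>x. x < 0 \<Longrightarrow> v x = 0"
    and anti: "\<And>x y. 0 \<le> x \<Longrightarrow> x \<le> y \<Longrightarrow> u y \<le> u x" "\<And>x y. 0 \<le> x \<Longrightarrow> x \<le> y \<Longrightarrow> v y \<le> v x"
      "\<And>x y. 0 \<le> x \<Longrightarrow> x \<le> y \<Longrightarrow> w y \<le> w x"
    and mid: "\<And>x y. 0 \<le> x \<Longrightarrow> 0 \<le> y \<Longrightarrow> u x * v y \<le> (w ((x + y) / 2))\<^sup>2"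
    and fin: "u 0 < \<top>" "v 0 < \<top>"
  shows "(\<integral>\<^sup>+x. u x \<partial>lborel) * (\<integral>\<^sup>+x. v x \<partial>lborel) \<le> (\<integral>\<^sup>+x. w x \<partial>lborel)\<^sup>2"
proof -
  have bound: "u x \<le> u 0" "v x \<le> v 0" for x
    using zero anti(1,2)[of 0 x] by (cases "x < 0"; simp)+
  show ?thesis
  proof (cases "u 0 = 0 \<or> v 0 = 0")
    case True
    then have "(\<forall>x. u x = 0) \<or> (\<forall>x. v x = 0)" using bound by (metis le_zero_eq)
    then show ?thesis by auto
  next
    case False
    obtain \<alpha> where \<alpha>: "u 0 = ennreal \<alpha>" "0 < \<alpha>"
      using fin False by (cases "u 0") (auto simp: less_le)
    obtain \<beta> where \<beta>: "v 0 = ennreal \<beta>" "0 < \<beta>"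
      using fin False by (cases "v 0") (auto simp: less_le)
    define \<gamma> where "\<gamma> = sqrt (\<alpha> * \<beta>)"
    have \<gamma>: "0 < \<gamma>" "\<gamma>\<^sup>2 = \<alpha> * \<beta>" using \<alpha> \<beta> by (auto simp: \<gamma>_def)
    define L :: "(real \<Rightarrow> ennreal) \<Rightarrow> real \<Rightarrow> ennreal"
      where "L = (\<lambda>h c. \<integral>\<^sup>+t. emeasure lborel {x. ennreal (c * t) < h x} * indicator {0<..<1} t \<partial>lborel)"
    have "(\<integral>\<^sup>+x. u x \<partial>lborel) = ennreal \<alpha> * L u \<alpha>"
      using nn_integral_layer_cake[of u \<alpha>] \<alpha> bound(1) by (simp add: L_def min_absorb1)
    moreover have "(\<integral>\<^sup>+x. v x \<partial>lborel) = ennreal \<beta> * L v \<beta>"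
      using nn_integral_layer_cake[of v \<beta>] \<beta> bound(2) by (simp add: L_def min_absorb1)
    moreover have "ennreal \<gamma> * L w \<gamma> \<le> (\<integral>\<^sup>+x. w x \<partial>lborel)"
      using nn_integral_layer_cake[of w \<gamma>] \<gamma> unfolding L_def
      by (metis (no_types, lifting) assms(3) min.cobounded1 nn_integral_mono)
    moreover have "L u \<alpha> + L v \<beta> \<le> 2 * L w \<gamma>"
    proof -
      have m: "emeasure lborel {x. ennreal (\<alpha> * t) < u x} + emeasure lborel {x. ennreal (\<beta> * t) < v x}
          \<le> 2 * emeasure lborel {x. ennreal (\<gamma> * t) < w x}" if t: "0 < t" "t < 1" for t
      proof (rule emeasure_initial_segment_midpoint)
        show "{x. ennreal (\<alpha> * t) < u x} \<subseteq> {0..}" "{x. ennreal (\<beta> * t) < v x} \<subseteq> {0..}"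
          using zero by (fastforce simp: not_le[symmetric])+
        have "ennreal (\<alpha> * t) < u 0" "ennreal (\<beta> * t) < v 0"
          using \<alpha> \<beta> t by (auto intro!: ennreal_lessI)
        then show "{x. ennreal (\<alpha> * t) < u x} \<noteq> {}" "{x. ennreal (\<beta> * t) < v x} \<noteq> {}" by auto
        show "x \<in> {x. ennreal (\<gamma> * t) < w x}"
          if "0 \<le> x" "x \<le> y" "y \<in> {x. ennreal (\<gamma> * t) < w x}" for x y
          using anti(3)[OF that(1,2)] that(3) by auto
        show "(x + y) / 2 \<in> {x. ennreal (\<gamma> * t) < w x}"
          if xy: "x \<in> {x. ennreal (\<alpha> * t) < u x}" "y \<in> {x. ennreal (\<beta> * t) < v x}" for x y
        proof (rule ccontr)
          assume "\<not> ?thesis"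
          then have "(w ((x + y) / 2))\<^sup>2 \<le> (ennreal (\<gamma> * t))\<^sup>2" by (intro power_mono) auto
          also have "\<dots> = ennreal (\<alpha> * t) * ennreal (\<beta> * t)"
            using \<gamma> \<alpha> \<beta> t by (simp add: ennreal_power ennreal_mult[symmetric] power_mult_distrib)
              (simp add: power2_eq_square algebra_simps)
          also have "\<dots> < u x * v y"
            using xy \<alpha> \<beta> t by (intro ennreal_mult_strict_mono) auto
          also have "\<dots> \<le> (w ((x + y) / 2))\<^sup>2"
          proof (rule mid)
            show "0 \<le> x" using xy(1) zero(1)[of x] by (cases "x < 0") auto
            show "0 \<le> y" using xy(2) zero(2)[of y] by (cases "y < 0") auto
          qed
          finally show False by simp
        qed
      qed simp_all
      have [measurable]: "(\<lambda>t. emeasure lborel {x. ennreal (c * t) < h x}) \<in> borel_measurable borel"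
        if [measurable]: "h \<in> borel_measurable borel" for c and h :: "real \<Rightarrow> ennreal"
      proof -
        have "(\<lambda>t. emeasure lborel {x. ennreal (c * t) < h x})
           = (\<lambda>t. \<integral>\<^sup>+x. (if ennreal (c * t) < h x then 1 else 0) \<partial>lborel)"
        proof
          fix t :: real
          have "(\<integral>\<^sup>+x. (if ennreal (c * t) < h x then 1 else 0) \<partial>lborel)
            = (\<integral>\<^sup>+x. indicator {x. ennreal (c * t) < h x} x \<partial>lborel)"
            by (intro nn_integral_cong) (auto simp: indicator_def)
          then show "emeasure lborel {x. ennreal (c * t) < h x} = (\<integral>\<^sup>+x. (if ennreal (c * t) < h x then 1 else 0) \<partial>lborel)"
            by simp
        qed
        then show ?thesis by simp
      qed
      have "L u \<alpha> + L v \<beta> = (\<integral>\<^sup>+t. (emeasure lborel {x. ennreal (\<alpha> * t) < u x} + emeasure lborel {x. ennreal (\<beta> * t) < v x}) * indicator {0<..<1} t \<partial>lborel)"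
        unfolding L_def by (subst nn_integral_add[symmetric]) (auto simp: distrib_right)
      also have "\<dots> \<le> (\<integral>\<^sup>+t. 2 * (emeasure lborel {x. ennreal (\<gamma> * t) < w x} * indicator {0<..<1} t) \<partial>lborel)"
        using m by (intro nn_integral_mono) (auto simp: indicator_def)
      also have "\<dots> = 2 * L w \<gamma>"
        unfolding L_def by (rule nn_integral_cmult) simp
      finally show ?thesis .
    qed
    \<comment> \<open>The arithmetic-geometric mean inequality. The levels were normalised by
      \<alpha>, \<beta> and \<gamma> so that the factor \<gamma>^2 = \<alpha>\<beta> comes out
      exactly.\<close>
    then have "L u \<alpha> * L v \<beta> \<le> (L w \<gamma>)\<^sup>2" by (rule ennreal_mult_le_square_of_add_le)
    ultimately have "(\<integral>\<^sup>+x. u x \<partial>lborel) * (\<integral>\<^sup>+x. v x \<partial>lborel) \<le> ennreal (\<alpha> * \<beta>) * (L w \<gamma>)\<^sup>2"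
      using \<alpha> \<beta> by (simp add: ennreal_mult mult.assoc mult.left_commute mult_left_mono)
    also have "\<dots> = (ennreal \<gamma> * L w \<gamma>)\<^sup>2"
      using \<gamma> by (simp add: power_mult_distrib ennreal_power flip: \<gamma>(2))
    also have "\<dots> \<le> (\<integral>\<^sup>+x. w x \<partial>lborel)\<^sup>2"
      using \<open>ennreal \<gamma> * L w \<gamma> \<le> _\<close> by (intro power_mono) auto
    finally show ?thesis .
  qed
qed

lemma nn_integral_SUP_min_nat:
  fixes h :: "real \<Rightarrow> ennreal"
  assumes [measurable]: "h \<in> borel_measurable borel"
  shows "(\<integral>\<^sup>+x. h x \<partial>lborel) = (SUP k::nat. \<integral>\<^sup>+x. min (h x) (of_nat k) \<partial>lborel)"
proof -
  have "h x = (SUP k::nat. min (h x) (of_nat k))" for x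
    by (simp flip: inf_min inf_SUP add: ennreal_SUP_of_nat_eq_top)
  then have "(\<integral>\<^sup>+x. h x \<partial>lborel) = (\<integral>\<^sup>+x. (SUP k::nat. min (h x) (of_nat k)) \<partial>lborel)"
    by simp
  also have "\<dots> = (SUP k::nat. \<integral>\<^sup>+x. min (h x) (of_nat k) \<partial>lborel)"
    by (rule nn_integral_monotone_convergence_SUP)
      (auto simp: incseq_def le_fun_def intro: min.coboundedI2)
  finally show ?thesis .
qed

text \<open>Iterated integrals carry no finiteness guarantee at the origin, so \<open>u\<close> and
  \<open>v\<close> are truncated at independent levels j and k. Truncation keeps monotonicity and
  can only lower the left side of \<open>mid\<close>, while \<open>w\<close> stays as it is;
  monotone convergence then removes the levels.\<close>

lemma prekopa_leindler_real:
  fixes u v w :: "real \<Rightarrow> ennreal"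
  assumes [measurable]: "u \<in> borel_measurable borel" "v \<in> borel_measurable borel" "w \<in> borel_measurable borel"
    and zero: "\<And>x. x < 0 \<Longrightarrow> u x = 0" "\<And>x. x < 0 \<Longrightarrow> v x = 0"
    and anti: "\<And>x y. 0 \<le> x \<Longrightarrow> x \<le> y \<Longrightarrow> u y \<le> u x" "\<And>x y. 0 \<le> x \<Longrightarrow> x \<le> y \<Longrightarrow> v y \<le> v x"
      "\<And>x y. 0 \<le> x \<Longrightarrow> x \<le> y \<Longrightarrow> w y \<le> w x"
    and mid: "\<And>x y. 0 \<le> x \<Longrightarrow> 0 \<le> y \<Longrightarrow> u x * v y \<le> (w ((x + y) / 2))\<^sup>2"
  shows "(\<integral>\<^sup>+x. u x \<partial>lborel) * (\<integral>\<^sup>+x. v x \<partial>lborel) \<le> (\<integral>\<^sup>+x. w x \<partial>lborel)\<^sup>2"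
proof -
  have trunc: "(\<integral>\<^sup>+x. min (u x) (of_nat j) \<partial>lborel) * (\<integral>\<^sup>+x. min (v x) (of_nat k) \<partial>lborel)
      \<le> (\<integral>\<^sup>+x. w x \<partial>lborel)\<^sup>2" for j k :: nat
  proof (rule prekopa_leindler_real_finite)
    fix x y :: real assume "0 \<le> x" "0 \<le> y"
    have "min (u x) (of_nat j) * min (v y) (of_nat k) \<le> u x * v y"
      by (intro mult_mono) auto
    also have "\<dots> \<le> (w ((x + y) / 2))\<^sup>2" by (rule mid) fact+
    finally show "min (u x) (of_nat j) * min (v y) (of_nat k) \<le> (w ((x + y) / 2))\<^sup>2" .
  qed (auto simp: zero anti min_less_iff_disj of_nat_less_top intro: min.coboundedI1)
  show ?thesis
    unfolding nn_integral_SUP_min_nat[of u, simplified] nn_integral_SUP_min_nat[of v, simplified]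
      SUP_mult_left_ennreal SUP_mult_right_ennreal
    using trunc by (auto intro!: SUP_least)
qed

section \<open>From the line to finitely many coordinates\<close>

interpretation lborel_PiM: product_sigma_finite "\<lambda>_. lborel :: real measure"
  by standard

text \<open>The class on which the induction over coordinates runs: it is closed under integrating
  out a coordinate, and vanishing off the orthant allows integrals over all of
  \<open>rspace I\<close> without indicators.\<close>

definition orthant_decreasing :: "'i set \<Rightarrow> (('i \<Rightarrow> real) \<Rightarrow> ennreal) \<Rightarrow> bool"
  where "orthant_decreasing I u \<longleftrightarrow>
    u \<in> borel_measurable (\<Pi>\<^sub>M e\<in>I. lborel) \<and>
    (\<forall>x\<in>rspace I - orthant I. u x = 0) \<and>
    (\<forall>x\<in>orthant I. \<forall>y\<in>orthant I. (\<forall>e\<in>I. x e \<le> y e) \<longrightarrow> u y \<le> u x)"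

lemma orthant_decreasingD:
  assumes "orthant_decreasing I u"
  shows "u \<in> borel_measurable (\<Pi>\<^sub>M e\<in>I. lborel)"
    and "x \<in> rspace I \<Longrightarrow> x \<notin> orthant I \<Longrightarrow> u x = 0"
    and "x \<in> orthant I \<Longrightarrow> y \<in> orthant I \<Longrightarrow> (\<And>e. e \<in> I \<Longrightarrow> x e \<le> y e) \<Longrightarrow> u y \<le> u x"
  using assms by (auto simp: orthant_decreasing_def)

lemma fun_upd_in_rspace: "x \<in> rspace I \<Longrightarrow> x(i := y) \<in> rspace (insert i I)"
  by (auto simp: PiE_iff extensional_def)

lemma fun_upd_in_orthant: "x \<in> orthant I \<Longrightarrow> 0 \<le> y \<Longrightarrow> x(i := y) \<in> orthant (insert i I)"
  by (auto simp: PiE_iff extensional_def)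

lemma fun_upd_in_orthantD:
  "i \<notin> I \<Longrightarrow> x \<in> rspace I \<Longrightarrow> x(i := y) \<in> orthant (insert i I) \<Longrightarrow> x \<in> orthant I \<and> 0 \<le> y"
  by (auto simp: PiE_iff extensional_def split: if_splits)

lemma orthant_subset_rspace: "orthant I \<subseteq> rspace I"
  by (auto simp: PiE_iff)

lemma orthant_decreasing_slice:
  assumes i: "i \<notin> I" and u: "orthant_decreasing (insert i I) u" and x: "x \<in> orthant I"
  shows "(\<lambda>y. u (x(i := y))) \<in> borel_measurable borel"
    and "y < 0 \<Longrightarrow> u (x(i := y)) = 0"
    and "0 \<le> y \<Longrightarrow> y \<le> z \<Longrightarrow> u (x(i := z)) \<le> u (x(i := y))"
proof -
  have "(\<lambda>y. x(i := y)) \<in> measurable lborel (\<Pi>\<^sub>M e\<in>insert i I. lborel)"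
    using x i by (intro measurable_component_update) (auto simp: space_PiM PiE_iff)
  then have "(\<lambda>y. u (x(i := y))) \<in> borel_measurable lborel"
    by (rule measurable_compose) (rule orthant_decreasingD(1)[OF u])
  then show "(\<lambda>y. u (x(i := y))) \<in> borel_measurable borel" by simp
  show "u (x(i := y)) = 0" if "y < 0"
    using that x i fun_upd_in_orthantD[OF i, of x y] orthant_subset_rspace
    by (intro orthant_decreasingD(2)[OF u] fun_upd_in_rspace) auto
  show "u (x(i := z)) \<le> u (x(i := y))" if "0 \<le> y" "y \<le> z"
    using that x by (intro orthant_decreasingD(3)[OF u] fun_upd_in_orthant) auto
qed

lemma orthant_decreasing_integrate_coordinate:
  assumes i: "i \<notin> I" and u: "orthant_decreasing (insert i I) u"
  shows "orthant_decreasing I (\<lambda>x. \<integral>\<^sup>+y. u (x(i := y)) \<partial>lborel)"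
  unfolding orthant_decreasing_def
proof (intro conjI ballI impI)
  have "(\<lambda>(x, y). x(i := y)) \<in> measurable ((\<Pi>\<^sub>M e\<in>I. lborel) \<Otimes>\<^sub>M lborel) (\<Pi>\<^sub>M e\<in>insert i I. lborel)"
    by (rule measurable_add_dim)
  from measurable_compose[OF this orthant_decreasingD(1)[OF u]]
  show "(\<lambda>x. \<integral>\<^sup>+y. u (x(i := y)) \<partial>lborel) \<in> borel_measurable (\<Pi>\<^sub>M e\<in>I. lborel)"
    by (intro lborel.borel_measurable_nn_integral) (simp add: case_prod_beta')
next
  fix x assume x: "x \<in> rspace I - orthant I"
  have "u (x(i := y)) = 0" for y
    using x fun_upd_in_orthantD[OF i, of x y]
    by (intro orthant_decreasingD(2)[OF u] fun_upd_in_rspace) auto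
  then show "(\<integral>\<^sup>+y. u (x(i := y)) \<partial>lborel) = 0" by simp
next
  fix x y assume xy: "x \<in> orthant I" "y \<in> orthant I" "\<forall>e\<in>I. x e \<le> y e"
  have "u (y(i := z)) \<le> u (x(i := z))" for z
  proof (cases "z < 0")
    case True
    then show ?thesis using orthant_decreasing_slice(2)[OF i u] xy by simp
  next
    case False
    then show ?thesis
      using xy i by (intro orthant_decreasingD(3)[OF u] fun_upd_in_orthant) auto
  qed
  then show "(\<integral>\<^sup>+z. u (y(i := z)) \<partial>lborel) \<le> (\<integral>\<^sup>+z. u (x(i := z)) \<partial>lborel)"
    by (intro nn_integral_mono)
qed

definition coord_midpoint :: "'i set \<Rightarrow> ('i \<Rightarrow> real) \<Rightarrow> ('i \<Rightarrow> real) \<Rightarrow> 'i \<Rightarrow> real"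
  where "coord_midpoint I x y = (\<lambda>e\<in>I. (x e + y e) / 2)"

lemma coord_midpoint_in_orthant: "x \<in> orthant I \<Longrightarrow> y \<in> orthant I \<Longrightarrow> coord_midpoint I x y \<in> orthant I"
  by (auto simp: coord_midpoint_def PiE_iff)

lemma coord_midpoint_fun_upd:
  "i \<notin> I \<Longrightarrow> coord_midpoint (insert i I) (x(i := a)) (y(i := b)) = (coord_midpoint I x y)(i := (a + b) / 2)"
  by (auto simp: coord_midpoint_def fun_eq_iff)

text \<open>For fixed \<open>x\<close> and \<open>y\<close> the three slices in direction
  \<open>i\<close> satisfy the hypotheses on the line. The conclusion is the midpoint hypothesis for
  the functions with \<open>i\<close> integrated out; it drives both the induction over coordinates
  and the logconcavity of marginals.\<close>

lemma prekopa_leindler_integrate_coordinate: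
  assumes i: "i \<notin> I"
    and u: "orthant_decreasing (insert i I) u" and v: "orthant_decreasing (insert i I) v"
    and w: "orthant_decreasing (insert i I) w"
    and mid: "\<And>x y. x \<in> orthant (insert i I) \<Longrightarrow> y \<in> orthant (insert i I) \<Longrightarrow>
      u x * v y \<le> (w (coord_midpoint (insert i I) x y))\<^sup>2"
    and x: "x \<in> orthant I" and y: "y \<in> orthant I"
  shows "(\<integral>\<^sup>+z. u (x(i := z)) \<partial>lborel) * (\<integral>\<^sup>+z. v (y(i := z)) \<partial>lborel)
    \<le> (\<integral>\<^sup>+z. w ((coord_midpoint I x y)(i := z)) \<partial>lborel)\<^sup>2"
proof (rule prekopa_leindler_real)
  fix a b :: real assume "0 \<le> a" "0 \<le> b"
  then show "u (x(i := a)) * v (y(i := b)) \<le> (w ((coord_midpoint I x y)(i := (a + b) / 2)))\<^sup>2"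
    using mid[of "x(i := a)" "y(i := b)"] x y i
    by (simp add: fun_upd_in_orthant coord_midpoint_fun_upd)
qed (use orthant_decreasing_slice[OF i u x] orthant_decreasing_slice[OF i v y]
      orthant_decreasing_slice[OF i w coord_midpoint_in_orthant[OF x y]] in auto)

theorem prekopa_leindler_PiM:
  assumes "finite I" "orthant_decreasing I u" "orthant_decreasing I v" "orthant_decreasing I w"
    and "\<And>x y. x \<in> orthant I \<Longrightarrow> y \<in> orthant I \<Longrightarrow> u x * v y \<le> (w (coord_midpoint I x y))\<^sup>2"
  shows "(\<integral>\<^sup>+x. u x \<partial>(\<Pi>\<^sub>M e\<in>I. lborel)) * (\<integral>\<^sup>+x. v x \<partial>(\<Pi>\<^sub>M e\<in>I. lborel))
    \<le> (\<integral>\<^sup>+x. w x \<partial>(\<Pi>\<^sub>M e\<in>I. lborel))\<^sup>2"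
  using assms
proof (induction I arbitrary: u v w rule: finite_induct)
  case empty
  have "coord_midpoint {} (\<lambda>k. undefined) (\<lambda>k. undefined) = (\<lambda>k::'a. undefined :: real)"
    by (simp add: coord_midpoint_def fun_eq_iff)
  then show ?case
    using empty(4)[of "\<lambda>k. undefined" "\<lambda>k. undefined"]
    by (simp add: lborel_PiM.nn_integral_empty)
next
  case (insert i I)
  note meas = orthant_decreasingD(1)[OF insert.prems(1)] orthant_decreasingD(1)[OF insert.prems(2)]
    orthant_decreasingD(1)[OF insert.prems(3)]
  show ?case
    unfolding lborel_PiM.product_nn_integral_insert[OF insert.hyps meas(1)]
      lborel_PiM.product_nn_integral_insert[OF insert.hyps meas(2)]
      lborel_PiM.product_nn_integral_insert[OF insert.hyps meas(3)]
    using insert.hyps(2) insert.prems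
    by (intro insert.IH orthant_decreasing_integrate_coordinate prekopa_leindler_integrate_coordinate)
qed

text \<open>Two instances matter: translation (a = 1) rewrites tails, and dilation by 1/2 (c = 0)
  produces the factor 2^|I| in the density comparison.\<close>

lemma nn_integral_PiM_lborel_affine:
  fixes c :: "'i \<Rightarrow> real" and a :: real
  assumes "finite I" "h \<in> borel_measurable (\<Pi>\<^sub>M e\<in>I. lborel)" and a: "0 < a"
  shows "(\<integral>\<^sup>+x. h x \<partial>(\<Pi>\<^sub>M e\<in>I. lborel)) =
    ennreal a ^ card I * (\<integral>\<^sup>+x. h (\<lambda>e\<in>I. c e + a * x e) \<partial>(\<Pi>\<^sub>M e\<in>I. lborel))"
  using assms(1,2)
proof (induction I arbitrary: h rule: finite_induct)
  case empty
  then show ?case by (simp add: PiM_empty nn_integral_count_space_finite restrict_def)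
next
  case (insert i I)
  note [measurable] = insert.prems
  have [measurable]: "(\<lambda>p. (fst p)(i := snd p)) \<in> measurable ((\<Pi>\<^sub>M e\<in>I. lborel) \<Otimes>\<^sub>M borel) (\<Pi>\<^sub>M e\<in>insert i I. lborel)"
    using measurable_add_dim[of i I "\<lambda>_. lborel :: real measure"] 
    by (simp add: case_prod_beta' cong: measurable_cong_sets)
  have upd[measurable]: "(\<lambda>y. x(i := y)) \<in> measurable borel (\<Pi>\<^sub>M e\<in>insert i I. lborel)"
    if "x \<in> space (\<Pi>\<^sub>M e\<in>I. lborel)" for x :: "'i \<Rightarrow> real"
    using measurable_component_update[OF that insert.hyps(2)] by simp
  have aff[measurable]: "(\<lambda>x. \<lambda>e\<in>J. c e + a * x e) \<in> measurable (\<Pi>\<^sub>M e\<in>J. lborel) (\<Pi>\<^sub>M e\<in>J. lborel)" for J :: "'i set"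
    by measurable
  define G where "G = (\<lambda>x. \<integral>\<^sup>+y. h (x(i := c i + a * y)) \<partial>lborel)"
  have "(\<lambda>p. (fst p)(i := c i + a * snd p)) \<in> measurable ((\<Pi>\<^sub>M e\<in>I. lborel) \<Otimes>\<^sub>M borel) (\<Pi>\<^sub>M e\<in>insert i I. lborel)"
    by (rule measurable_compose[of "\<lambda>p. (fst p, c i + a * snd p)", OF _ \<open>(\<lambda>p. (fst p)(i := snd p)) \<in> _\<close>, simplified]) measurable
  from measurable_compose[OF this insert.prems]
  have G[measurable]: "G \<in> borel_measurable (\<Pi>\<^sub>M e\<in>I. lborel)"
    unfolding G_def by (intro lborel.borel_measurable_nn_integral) (simp add: case_prod_beta' cong: measurable_cong_sets)
  have "(\<integral>\<^sup>+x. h x \<partial>(\<Pi>\<^sub>M e\<in>insert i I. lborel)) = (\<integral>\<^sup>+x. (\<integral>\<^sup>+y. h (x(i := y)) \<partial>lborel) \<partial>(\<Pi>\<^sub>M e\<in>I. lborel))"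
    by (rule lborel_PiM.product_nn_integral_insert) fact+
  also have "\<dots> = (\<integral>\<^sup>+x. ennreal a * G x \<partial>(\<Pi>\<^sub>M e\<in>I. lborel))"
  proof (intro nn_integral_cong)
    fix x :: "'i \<Rightarrow> real" assume "x \<in> space (\<Pi>\<^sub>M e\<in>I. lborel)"
    then have "(\<lambda>y. h (x(i := y))) \<in> borel_measurable borel"
      by (rule measurable_compose[OF upd insert.prems])
    from nn_integral_real_affine[OF this, of a "c i"] a
    show "(\<integral>\<^sup>+y. h (x(i := y)) \<partial>lborel) = ennreal a * G x"
      unfolding G_def by simp
  qed
  also have "\<dots> = ennreal a * (\<integral>\<^sup>+x. G x \<partial>(\<Pi>\<^sub>M e\<in>I. lborel))"
    by (rule nn_integral_cmult) measurable
  also have "(\<integral>\<^sup>+x. G x \<partial>(\<Pi>\<^sub>M e\<in>I. lborel)) = ennreal a ^ card I * (\<integral>\<^sup>+x. G (\<lambda>e\<in>I. c e + a * x e) \<partial>(\<Pi>\<^sub>M e\<in>I. lborel))"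
    by (rule insert.IH) measurable
  also have "(\<integral>\<^sup>+x. G (\<lambda>e\<in>I. c e + a * x e) \<partial>(\<Pi>\<^sub>M e\<in>I. lborel)) =
     (\<integral>\<^sup>+x. (\<integral>\<^sup>+y. h (\<lambda>e\<in>insert i I. c e + a * (x(i := y)) e) \<partial>lborel) \<partial>(\<Pi>\<^sub>M e\<in>I. lborel))"
    unfolding G_def
    using insert.hyps by (intro nn_integral_cong arg_cong[where f = h]) (auto simp: fun_eq_iff)
  also have "\<dots> = (\<integral>\<^sup>+x. h (\<lambda>e\<in>insert i I. c e + a * x e) \<partial>(\<Pi>\<^sub>M e\<in>insert i I. lborel))"
    by (rule lborel_PiM.product_nn_integral_insert[symmetric]) (use insert.hyps in measurable)
  finally show ?case
    by (simp only: card_insert_disjoint[OF insert.hyps] power_Suc mult.assoc)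
qed

section \<open>Marginals and tails\<close>

text \<open>The density is \<open>ennreal\<close>-valued because a marginal density arises as an
  integral whose finiteness is not known beforehand; the squared midpoint inequality makes sense for
  infinite values too.\<close>

locale decreasing_logconcave =
  fixes I :: "'i set" and f :: "('i \<Rightarrow> real) \<Rightarrow> ennreal" and F :: "('i \<Rightarrow> real) measure"
  assumes finite_I: "finite I"
    and decreasing: "orthant_decreasing I f"
    and midpoint_logconcave:
      "x \<in> orthant I \<Longrightarrow> y \<in> orthant I \<Longrightarrow> f x * f y \<le> (f (coord_midpoint I x y))\<^sup>2"
    and total: "(\<integral>\<^sup>+x. f x \<partial>(\<Pi>\<^sub>M e\<in>I. lborel)) = 1"
    and F_eq: "F = density (\<Pi>\<^sub>M e\<in>I. lborel) f"
begin

lemma f_measurable [measurable]: "f \<in> borel_measurable (\<Pi>\<^sub>M e\<in>I. lborel)"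
  using decreasing by (simp add: orthant_decreasing_def)

lemma f_zero: "x \<in> rspace I \<Longrightarrow> x \<notin> orthant I \<Longrightarrow> f x = 0"
  using decreasing by (simp add: orthant_decreasing_def)

lemma f_antimono: "x \<in> orthant I \<Longrightarrow> y \<in> orthant I \<Longrightarrow> (\<And>e. e \<in> I \<Longrightarrow> x e \<le> y e) \<Longrightarrow> f y \<le> f x"
  using decreasing by (simp add: orthant_decreasing_def)

lemma sets_F [simp, measurable_cong]: "sets F = sets (\<Pi>\<^sub>M e\<in>I. lborel)"
  by (simp add: F_eq)

lemma space_F [simp]: "space F = rspace I"
  by (simp add: F_eq space_PiM)

lemma emeasure_F: "X \<in> sets (\<Pi>\<^sub>M e\<in>I. lborel) \<Longrightarrow>
    emeasure F X = (\<integral>\<^sup>+x. f x * indicator X x \<partial>(\<Pi>\<^sub>M e\<in>I. lborel))"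
  unfolding F_eq by (rule emeasure_density[OF f_measurable])

lemma orthant_sets: "orthant I \<in> sets (\<Pi>\<^sub>M e\<in>I. lborel)"
  using finite_I by (intro sets_PiM_I_finite) auto

sublocale prob_space F
proof
  have "emeasure F (space F) = (\<integral>\<^sup>+x. f x * indicator (space (\<Pi>\<^sub>M e\<in>I. lborel)) x \<partial>(\<Pi>\<^sub>M e\<in>I. lborel))"
    using emeasure_F[OF sets.top] by (simp add: F_eq)
  also have "\<dots> = (\<integral>\<^sup>+x. f x \<partial>(\<Pi>\<^sub>M e\<in>I. lborel))"
    by (intro nn_integral_cong) simp
  finally show "emeasure F (space F) = 1" using total by simp
qed

text \<open>The midpoint inequality passes to the marginal by the inequality on the line, applied to
  slices; the identification of the density is Fubini.\<close>

lemma marginal_coordinate: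
  assumes I: "I = insert i J" and i: "i \<notin> J"
  shows "decreasing_logconcave J (\<lambda>x. \<integral>\<^sup>+y. f (x(i := y)) \<partial>lborel)
    (distr F (\<Pi>\<^sub>M e\<in>J. lborel) (\<lambda>x. restrict x J))"
proof -
  have fin: "finite J" using finite_I I by simp
  have dec: "orthant_decreasing (insert i J) f" using decreasing I by simp
  have dec': "orthant_decreasing J (\<lambda>x. \<integral>\<^sup>+y. f (x(i := y)) \<partial>lborel)"
    by (rule orthant_decreasing_integrate_coordinate[OF i dec])
  note [measurable] = orthant_decreasingD(1)[OF dec'] orthant_decreasingD(1)[OF dec]
  have fubini: "(\<integral>\<^sup>+x. h x \<partial>(\<Pi>\<^sub>M e\<in>I. lborel)) = (\<integral>\<^sup>+x. (\<integral>\<^sup>+y. h (x(i := y)) \<partial>lborel) \<partial>(\<Pi>\<^sub>M e\<in>J. lborel))"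
    if "h \<in> borel_measurable (\<Pi>\<^sub>M e\<in>I. lborel)" for h :: "('i \<Rightarrow> real) \<Rightarrow> ennreal"
    using lborel_PiM.product_nn_integral_insert[OF fin i that[unfolded I]] unfolding I .
  show ?thesis
  proof
    show "(\<integral>\<^sup>+y. f (x(i := y)) \<partial>lborel) * (\<integral>\<^sup>+z. f (y(i := z)) \<partial>lborel)
      \<le> (\<integral>\<^sup>+z. f ((coord_midpoint J x y)(i := z)) \<partial>lborel)\<^sup>2"
      if "x \<in> orthant J" "y \<in> orthant J" for x y
      using midpoint_logconcave I that
      by (intro prekopa_leindler_integrate_coordinate[OF i dec dec dec]) auto
    show "(\<integral>\<^sup>+x. (\<integral>\<^sup>+y. f (x(i := y)) \<partial>lborel) \<partial>(\<Pi>\<^sub>M e\<in>J. lborel)) = 1"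
      using total fubini[OF f_measurable] by simp
    show "distr F (\<Pi>\<^sub>M e\<in>J. lborel) (\<lambda>x. restrict x J) =
      density (\<Pi>\<^sub>M e\<in>J. lborel) (\<lambda>x. \<integral>\<^sup>+y. f (x(i := y)) \<partial>lborel)"
    proof (rule measure_eqI)
      fix A assume "A \<in> sets (distr F (\<Pi>\<^sub>M e\<in>J. lborel) (\<lambda>x. restrict x J))"
      then have A[measurable]: "A \<in> sets (\<Pi>\<^sub>M e\<in>J. lborel)" by simp
      have [measurable]: "(\<lambda>x. restrict x J) \<in> measurable (\<Pi>\<^sub>M e\<in>I. lborel) (\<Pi>\<^sub>M e\<in>J. lborel :: real measure)"
        using I by (intro measurable_restrict_subset) auto
      have slice: "(\<lambda>y. f (x(i := y))) \<in> borel_measurable borel" if x: "x \<in> rspace J" for x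
      proof -
        have "(\<lambda>y. x(i := y)) \<in> measurable lborel (\<Pi>\<^sub>M e\<in>insert i J. lborel)"
          using x i by (intro measurable_component_update) (auto simp: space_PiM)
        from measurable_compose[OF this orthant_decreasingD(1)[OF dec]]
        show ?thesis by simp
      qed
      have "emeasure (distr F (\<Pi>\<^sub>M e\<in>J. lborel) (\<lambda>x. restrict x J)) A =
          emeasure F ((\<lambda>x. restrict x J) -` A \<inter> space F)"
        by (rule emeasure_distr) measurable
      also have "\<dots> = (\<integral>\<^sup>+x. f x * indicator ((\<lambda>x. restrict x J) -` A \<inter> space F) x \<partial>(\<Pi>\<^sub>M e\<in>I. lborel))"
      proof (rule emeasure_F)
        have "(\<lambda>x. restrict x J) \<in> measurable F (\<Pi>\<^sub>M e\<in>J. lborel)" by measurable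
        from measurable_sets[OF this A]
        show "(\<lambda>x. restrict x J) -` A \<inter> space F \<in> sets (\<Pi>\<^sub>M e\<in>I. lborel)"
          unfolding sets_F .
      qed
      also have "\<dots> = (\<integral>\<^sup>+x. f x * indicator A (restrict x J) \<partial>(\<Pi>\<^sub>M e\<in>I. lborel))"
        by (intro nn_integral_cong) (auto simp: indicator_def space_PiM)
      also have "\<dots> = (\<integral>\<^sup>+x. (\<integral>\<^sup>+y. f (x(i := y)) * indicator A (restrict (x(i := y)) J) \<partial>lborel) \<partial>(\<Pi>\<^sub>M e\<in>J. lborel))"
        by (rule fubini) measurable
      also have "\<dots> = (\<integral>\<^sup>+x. (\<integral>\<^sup>+y. f (x(i := y)) \<partial>lborel) * indicator A x \<partial>(\<Pi>\<^sub>M e\<in>J. lborel))"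
      proof (rule nn_integral_cong)
        fix x :: "'i \<Rightarrow> real" assume "x \<in> space (\<Pi>\<^sub>M e\<in>J. lborel)"
        then have x: "x \<in> rspace J" by (simp add: space_PiM)
        then have "restrict (x(i := y)) J = x" for y using i by (auto simp: fun_eq_iff PiE_iff extensional_def)
        then show "(\<integral>\<^sup>+y. f (x(i := y)) * indicator A (restrict (x(i := y)) J) \<partial>lborel) =
            (\<integral>\<^sup>+y. f (x(i := y)) \<partial>lborel) * indicator A x"
          using slice[OF x] by (simp add: nn_integral_multc)
      qed
      also have "\<dots> = emeasure (density (\<Pi>\<^sub>M e\<in>J. lborel) (\<lambda>x. \<integral>\<^sup>+y. f (x(i := y)) \<partial>lborel)) A"
        by (rule emeasure_density[symmetric]) measurable
      finally show "emeasure (distr F (\<Pi>\<^sub>M e\<in>J. lborel) (\<lambda>x. restrict x J)) A =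
        emeasure (density (\<Pi>\<^sub>M e\<in>J. lborel) (\<lambda>x. \<integral>\<^sup>+y. f (x(i := y)) \<partial>lborel)) A" .
    qed simp
  qed fact+
qed

end

text \<open>Coordinates outside \<open>S\<close> are integrated out one by one. The index set has
  the form \<open>S \<union> J\<close> so that the induction shrinks \<open>J\<close> while the
  target \<open>S\<close> stays fixed; \<open>f\<close> and \<open>F\<close> vary because each step
  continues with a marginal.\<close>

lemma decreasing_logconcave_marginal_Un:
  assumes "finite J" "S \<inter> J = {}" "decreasing_logconcave (S \<union> J) f F"
  shows "\<exists>g. decreasing_logconcave S g (distr F (\<Pi>\<^sub>M e\<in>S. lborel) (\<lambda>x. restrict x S))"
  using assms
proof (induction J arbitrary: f F rule: finite_induct)
  case empty
  then interpret decreasing_logconcave S f F by simp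
  have "distr F (\<Pi>\<^sub>M e\<in>S. lborel) (\<lambda>x. restrict x S) = distr F F (\<lambda>x. x)"
    by (intro distr_cong) (auto simp: PiE_iff extensional_restrict)
  also have "\<dots> = F" by (rule distr_id)
  finally show ?case using decreasing_logconcave_axioms by (intro exI[of _ f]) (simp only:)
next
  case (insert j J)
  then interpret decreasing_logconcave "S \<union> insert j J" f F by simp
  let ?F = "distr F (\<Pi>\<^sub>M e\<in>S \<union> J. lborel) (\<lambda>x. restrict x (S \<union> J))"
  have "decreasing_logconcave (S \<union> J) (\<lambda>x. \<integral>\<^sup>+y. f (x(j := y)) \<partial>lborel) ?F"
    using insert.hyps insert.prems by (intro marginal_coordinate) auto
  moreover have "S \<inter> J = {}" using insert.prems by auto
  ultimately obtain g where g: "decreasing_logconcave S g (distr ?F (\<Pi>\<^sub>M e\<in>S. lborel) (\<lambda>x. restrict x S))"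
    using insert.IH by blast
  have "distr ?F (\<Pi>\<^sub>M e\<in>S. lborel) (\<lambda>x. restrict x S) =
      distr F (\<Pi>\<^sub>M e\<in>S. lborel) ((\<lambda>x. restrict x S) \<circ> (\<lambda>x. restrict x (S \<union> J)))"
  proof (rule distr_distr)
    show "(\<lambda>x. restrict x S) \<in> measurable (\<Pi>\<^sub>M e\<in>S \<union> J. lborel) (\<Pi>\<^sub>M e\<in>S. lborel)"
      by (rule measurable_restrict_subset) auto
    have "(\<lambda>x. restrict x (S \<union> J)) \<in> measurable (\<Pi>\<^sub>M e\<in>S \<union> insert j J. lborel) (\<Pi>\<^sub>M e\<in>S \<union> J. lborel :: real measure)"
      by (rule measurable_restrict_subset) auto
    then show "(\<lambda>x. restrict x (S \<union> J)) \<in> measurable F (\<Pi>\<^sub>M e\<in>S \<union> J. lborel)"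
      by (simp cong: measurable_cong_sets)
  qed
  also have "(\<lambda>x. restrict x S) \<circ> (\<lambda>x. restrict x (S \<union> J)) = (\<lambda>x::'a \<Rightarrow> real. restrict x S)"
    by (auto simp: fun_eq_iff restrict_def)
  finally show ?case using g by (intro exI[of _ g]) (simp only:)
qed

lemma (in decreasing_logconcave) marginal:
  assumes "S \<subseteq> I"
  shows "\<exists>g. decreasing_logconcave S g (distr F (\<Pi>\<^sub>M e\<in>S. lborel) (\<lambda>x. restrict x S))"
proof (rule decreasing_logconcave_marginal_Un)
  show "finite (I - S)" using finite_I by simp
  show "decreasing_logconcave (S \<union> (I - S)) f F"
    using assms decreasing_logconcave_axioms by (simp add: Un_absorb1)
qed auto

text \<open>At l = 1/2 logconcavity bounds the product of the square roots of f x and f y by the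
  value at the midpoint; squaring gives the form without powers.\<close>

lemma down_monotone_logconcave_distribution_imp:
  assumes "down_monotone_logconcave_distribution I F" "finite I"
  shows "\<exists>f. decreasing_logconcave I f F"
proof -
  from assms obtain f where F: "prob_space F" "F = density (\<Pi>\<^sub>M e\<in>I. lborel) (\<lambda>x. ennreal (f x))"
    and [measurable]: "f \<in> borel_measurable (\<Pi>\<^sub>M e\<in>I. lborel)"
    and lc: "logconcave I f" and supp: "supported_in_orthant I f" and mono: "down_monotone I f"
    unfolding down_monotone_logconcave_distribution_def by auto
  have "decreasing_logconcave I (\<lambda>x. ennreal (f x)) F"
  proof
    show "orthant_decreasing I (\<lambda>x. ennreal (f x))"
      using supp mono unfolding orthant_decreasing_def supported_in_orthant_def down_monotone_def
      by (auto intro!: ennreal_leI)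
    show "ennreal (f x) * ennreal (f y) \<le> (ennreal (f (coord_midpoint I x y)))\<^sup>2"
      if "x \<in> orthant I" "y \<in> orthant I" for x y
    proof -
      have xy: "x \<in> rspace I" "y \<in> rspace I" using that orthant_subset_rspace by blast+
      then have nonneg: "0 \<le> f x" "0 \<le> f y" using lc by (auto simp: logconcave_def)
      have "f x powr (1/2) * f y powr (1 - 1/2) \<le> f (\<lambda>e\<in>I. 1/2 * x e + (1 - 1/2) * y e)"
        by (rule bspec[of "{0..1::real}" "\<lambda>l. f x powr l * f y powr (1 - l) \<le> f (\<lambda>e\<in>I. l * x e + (1 - l) * y e)"])
          (use lc xy in \<open>auto simp: logconcave_def\<close>)
      also have "(\<lambda>e\<in>I. 1/2 * x e + (1 - 1/2) * y e) = coord_midpoint I x y"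
        by (auto simp: coord_midpoint_def fun_eq_iff)
      finally have "sqrt (f x) * sqrt (f y) \<le> f (coord_midpoint I x y)"
        using nonneg by (simp add: powr_half_sqrt)
      then have "(sqrt (f x) * sqrt (f y))\<^sup>2 \<le> (f (coord_midpoint I x y))\<^sup>2"
        using nonneg by (intro power_mono) auto
      then have "f x * f y \<le> (f (coord_midpoint I x y))\<^sup>2"
        using nonneg by (simp add: power_mult_distrib)
      moreover have "0 \<le> f (coord_midpoint I x y)"
        using lc coord_midpoint_in_orthant[OF that] orthant_subset_rspace by (auto simp: logconcave_def)
      ultimately show ?thesis
        using nonneg by (simp add: ennreal_mult[symmetric] ennreal_power ennreal_leI)
    qed
    have "emeasure F (space F) = (\<integral>\<^sup>+x. ennreal (f x) * indicator (space (\<Pi>\<^sub>M e\<in>I. lborel)) x \<partial>(\<Pi>\<^sub>M e\<in>I. lborel))"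
      unfolding F(2) by (subst emeasure_density) auto
    also have "\<dots> = (\<integral>\<^sup>+x. f x \<partial>(\<Pi>\<^sub>M e\<in>I. lborel))"
      by (intro nn_integral_cong) simp
    finally show "(\<integral>\<^sup>+x. f x \<partial>(\<Pi>\<^sub>M e\<in>I. lborel)) = 1"
      using prob_space.emeasure_space_1[OF F(1)] by simp
  qed fact+
  then show ?thesis by (rule exI[where x = "\<lambda>x. ennreal (f x)"])
qed

section \<open>Tails of sets of coordinates\<close>

context decreasing_logconcave
begin

text \<open>The factor in \<open>1 * x e\<close> matches the shape \<open>c e + a * x e\<close> of
  \<open>nn_integral_PiM_lborel_affine\<close> at a = 1.\<close>

definition shift :: "'i set \<Rightarrow> real \<Rightarrow> ('i \<Rightarrow> real) \<Rightarrow> 'i \<Rightarrow> real"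
  where "shift A t x = (\<lambda>e\<in>I. (if e \<in> A then t else 0) + 1 * x e)"

lemma shift_measurable [measurable]:
  "shift A t \<in> measurable (\<Pi>\<^sub>M e\<in>I. lborel) (\<Pi>\<^sub>M e\<in>I. lborel)"
  unfolding shift_def by measurable

lemma shift_in_rspace: "shift A t x \<in> rspace I"
  by (auto simp: shift_def)

lemma nn_integral_shift:
  "h \<in> borel_measurable (\<Pi>\<^sub>M e\<in>I. lborel) \<Longrightarrow>
    (\<integral>\<^sup>+x. h x \<partial>(\<Pi>\<^sub>M e\<in>I. lborel)) = (\<integral>\<^sup>+x. h (shift A t x) \<partial>(\<Pi>\<^sub>M e\<in>I. lborel))"
  unfolding shift_def
  by (subst nn_integral_PiM_lborel_affine[OF finite_I, where a = 1 and c = "\<lambda>e. if e \<in> A then t else 0"]) auto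

text \<open>A negative coordinate outside \<open>A\<close> survives the shift; a negative coordinate
  in \<open>A\<close> could be lifted into the orthant, which is why it is excluded.\<close>

lemma f_shift_eq_zero:
  assumes "x \<in> rspace I" "x \<notin> orthant I" "\<And>e. e \<in> A \<Longrightarrow> 0 \<le> x e"
  shows "f (shift A t x) = 0"
proof (rule f_zero[OF shift_in_rspace])
  obtain e where "e \<in> I" "x e < 0" using assms(1,2) by (auto simp: PiE_iff not_le)
  moreover have "e \<notin> A" using assms(3)[of e] \<open>x e < 0\<close> by auto
  ultimately show "shift A t x \<notin> orthant I" by (auto simp: shift_def PiE_iff)
qed

lemma f_shift_le:
  assumes "x \<in> rspace I" "\<And>e. e \<in> A \<Longrightarrow> 0 \<le> x e" "0 \<le> t"
  shows "f (shift A t x) \<le> f x"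
proof (cases "x \<in> orthant I")
  case True
  with assms show ?thesis by (intro f_antimono) (auto simp: shift_def PiE_iff)
next
  case False
  with assms show ?thesis by (simp add: f_shift_eq_zero)
qed

lemma upper_set_measurable:
  assumes "A \<subseteq> I"
  shows "{x \<in> rspace I. \<forall>e\<in>A. t \<le> x e} \<in> sets (\<Pi>\<^sub>M e\<in>I. lborel)"
proof -
  have "finite A" using assms finite_I by (rule finite_subset)
  moreover have "(\<lambda>x. x e) \<in> borel_measurable (\<Pi>\<^sub>M e\<in>I. lborel)" if "e \<in> A" for e
    using measurable_component_singleton[of e I "\<lambda>_. lborel"] that assms by auto
  ultimately have "{x \<in> space (\<Pi>\<^sub>M e\<in>I. lborel). \<forall>e\<in>A. t \<le> x e} \<in> sets (\<Pi>\<^sub>M e\<in>I. lborel)"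
    by (intro sets.sets_Collect_finite_All borel_measurable_le) auto
  then show ?thesis by (simp add: space_PiM)
qed

definition tail :: "'i set \<Rightarrow> real \<Rightarrow> ennreal"
  where "tail A t = emeasure F {x \<in> rspace I. \<forall>e\<in>A. t \<le> x e}"

text \<open>After the translation the domain is the orthant for every t and the level has moved into
  the integrand. For nonnegative levels the integrands are in the class
  \<open>orthant_decreasing\<close>, so tails at different levels can be compared by the
  Prekopa-Leindler inequality.\<close>

lemma tail_eq_nn_integral_shift:
  assumes A: "A \<subseteq> I"
  shows "tail A t = (\<integral>\<^sup>+x. f (shift A t x) * indicator (orthant I) x \<partial>(\<Pi>\<^sub>M e\<in>I. lborel))"
proof -
  let ?X = "\<lambda>t. {x \<in> rspace I. \<forall>e\<in>A. t \<le> x e}"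
  have "tail A t = (\<integral>\<^sup>+x. f x * indicator (?X t) x \<partial>(\<Pi>\<^sub>M e\<in>I. lborel))"
    unfolding tail_def using A by (intro emeasure_F upper_set_measurable)
  also have "\<dots> = (\<integral>\<^sup>+x. f (shift A t x) * indicator (?X t) (shift A t x) \<partial>(\<Pi>\<^sub>M e\<in>I. lborel))"
    by (intro nn_integral_shift borel_measurable_times_ennreal f_measurable
        borel_measurable_indicator upper_set_measurable[OF A])
  also have "\<dots> = (\<integral>\<^sup>+x. f (shift A t x) * indicator (orthant I) x \<partial>(\<Pi>\<^sub>M e\<in>I. lborel))"
  proof (rule nn_integral_cong)
    fix x :: "'i \<Rightarrow> real" assume "x \<in> space (\<Pi>\<^sub>M e\<in>I. lborel)"
    then have x: "x \<in> rspace I" by (simp add: space_PiM)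
    have *: "shift A t x \<in> ?X t \<longleftrightarrow> (\<forall>e\<in>A. 0 \<le> x e)"
      using A shift_in_rspace by (auto simp: shift_def)
    show "f (shift A t x) * indicator (?X t) (shift A t x) = f (shift A t x) * indicator (orthant I) x"
    proof (cases "\<forall>e\<in>A. 0 \<le> x e")
      case True
      then have "f (shift A t x) = 0" if "x \<notin> orthant I"
        using f_shift_eq_zero[OF x that] by blast
      then show ?thesis using True * by (auto simp: indicator_def)
    next
      case False
      then have "x \<notin> orthant I" using A by (auto simp: PiE_iff)
      then show ?thesis using False * by (simp add: indicator_def)
    qed
  qed
  finally show ?thesis .
qed

lemma orthant_decreasing_shift:
  assumes "0 \<le> t"
  shows "orthant_decreasing I (\<lambda>x. f (shift A t x) * indicator (orthant I) x)"
  unfolding orthant_decreasing_def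
proof (intro conjI ballI impI)
  show "(\<lambda>x. f (shift A t x) * indicator (orthant I) x) \<in> borel_measurable (\<Pi>\<^sub>M e\<in>I. lborel)"
    using orthant_sets by measurable
  fix x y assume "x \<in> orthant I" "y \<in> orthant I" "\<forall>e\<in>I. x e \<le> y e"
  then show "f (shift A t y) * indicator (orthant I) y \<le> f (shift A t x) * indicator (orthant I) x"
    using assms by (auto intro!: f_antimono simp: shift_def PiE_iff)
qed auto

lemma tail_0: "A \<subseteq> I \<Longrightarrow> tail A 0 = 1"
proof -
  assume A: "A \<subseteq> I"
  have "tail A 0 = (\<integral>\<^sup>+x. f x \<partial>(\<Pi>\<^sub>M e\<in>I. lborel))"
    unfolding tail_eq_nn_integral_shift[OF A]
  proof (rule nn_integral_cong)
    fix x :: "'i \<Rightarrow> real" assume "x \<in> space (\<Pi>\<^sub>M e\<in>I. lborel)"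
    then have x: "x \<in> rspace I" by (simp add: space_PiM)
    then have "shift A 0 x = x" by (auto simp: shift_def fun_eq_iff PiE_iff extensional_def)
    then show "f (shift A 0 x) * indicator (orthant I) x = f x"
      using f_zero[OF x] by (auto simp: indicator_def)
  qed
  then show ?thesis using total by simp
qed

text \<open>The midpoint of a point shifted by 2t and a point shifted by 0 is their midpoint shifted
  by t. So the Prekopa-Leindler inequality applies to the levels 2t, 0 and t, and level 0 has mass
  one.\<close>

lemma tail_double:
  assumes A: "A \<subseteq> I" and t: "0 \<le> t"
  shows "tail A (2 * t) \<le> (tail A t)\<^sup>2"
proof -
  have "tail A (2 * t) * tail A 0 \<le> (tail A t)\<^sup>2"
    unfolding tail_eq_nn_integral_shift[OF A]
  proof (rule prekopa_leindler_PiM)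
    fix x y assume xy: "x \<in> orthant I" "y \<in> orthant I"
    have "shift A s z \<in> orthant I" if "z \<in> orthant I" "0 \<le> s" for z s
      using that by (auto simp: shift_def PiE_iff)
    then have "f (shift A (2 * t) x) * f (shift A 0 y) \<le> (f (coord_midpoint I (shift A (2 * t) x) (shift A 0 y)))\<^sup>2"
      using xy t by (intro midpoint_logconcave) auto
    also have "coord_midpoint I (shift A (2 * t) x) (shift A 0 y) = shift A t (coord_midpoint I x y)"
      by (auto simp: coord_midpoint_def shift_def fun_eq_iff add_divide_distrib)
    finally show "f (shift A (2 * t) x) * indicator (orthant I) x * (f (shift A 0 y) * indicator (orthant I) y)
        \<le> (f (shift A t (coord_midpoint I x y)) * indicator (orthant I) (coord_midpoint I x y))\<^sup>2"
      using xy coord_midpoint_in_orthant[OF xy] by simp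
  qed (use finite_I t orthant_decreasing_shift in auto)
  then show ?thesis using tail_0[OF A] by simp
qed

lemma tail_double_power:
  assumes A: "A \<subseteq> I" and t: "0 \<le> t"
  shows "tail A (2 ^ j * t) \<le> tail A t ^ (2 ^ j)"
proof (induction j)
  case (Suc j)
  have "tail A (2 ^ Suc j * t) \<le> (tail A (2 ^ j * t))\<^sup>2"
    using tail_double[OF A, of "2 ^ j * t"] t by (simp add: mult.assoc)
  also have "\<dots> \<le> (tail A t ^ (2 ^ j))\<^sup>2"
    using Suc by (intro power_mono) auto
  finally show ?case by (simp add: power_mult[symmetric] mult.commute)
qed simp

end

lemma ennreal_le_suminf: "h j \<le> (\<Sum>j. h j)" for h :: "nat \<Rightarrow> ennreal"
  using sum_le_suminf[of h "{j}"] by simp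

context decreasing_logconcave
begin

section \<open>Second moments of the coordinates\<close>

lemma coordinate_measurable [measurable]: "e \<in> I \<Longrightarrow> (\<lambda>x. x e) \<in> borel_measurable F"
  using measurable_component_singleton[of e I "\<lambda>_. lborel :: real measure"] by simp

lemma upper_set_in_events: "A \<subseteq> I \<Longrightarrow> {x \<in> rspace I. \<forall>e\<in>A. t \<le> x e} \<in> sets F"
  unfolding sets_F by (rule upper_set_measurable)

lemma AE_orthant: "AE x in F. x \<in> orthant I"
proof -
  have "{x \<in> rspace I. \<forall>e\<in>I. 0 \<le> x e} = orthant I" by (auto simp: PiE_iff extensional_def)
  then have "emeasure F (orthant I) = 1" using tail_0[of I] by (simp add: tail_def)
  then have "prob (orthant I) = 1" by (simp add: measure_def)
  then show ?thesis by (intro AE_prob_1)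
qed

lemma AE_nonneg: "e \<in> I \<Longrightarrow> AE x in F. 0 \<le> x e"
  using AE_orthant by eventually_elim (auto simp: PiE_iff)

text \<open>The tail decays doubly exponentially along the scales \<open>2 ^ j * a\<close>.\<close>

lemma second_moment_le:
  assumes e: "e \<in> I" and a: "0 < a" and tail: "tail {e} a \<le> ennreal (1/8)"
  shows "(\<integral>\<^sup>+x. ennreal ((x e)\<^sup>2) \<partial>F) \<le> ennreal (2 * a\<^sup>2)"
proof -
  let ?X = "\<lambda>t. {x \<in> rspace I. \<forall>e'\<in>{e}. t \<le> x e'}"
  have X[measurable]: "?X t \<in> sets F" for t
    using e by (intro upper_set_in_events) auto
  have "(\<integral>\<^sup>+x. ennreal ((x e)\<^sup>2) \<partial>F) \<le>
    (\<integral>\<^sup>+x. ennreal (a\<^sup>2) + (\<Sum>j. ennreal ((2 ^ Suc j * a)\<^sup>2) * indicator (?X (2 ^ j * a)) x) \<partial>F)"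
  proof (rule nn_integral_mono_AE)
    show "AE x in F. ennreal ((x e)\<^sup>2) \<le>
      ennreal (a\<^sup>2) + (\<Sum>j. ennreal ((2 ^ Suc j * a)\<^sup>2) * indicator (?X (2 ^ j * a)) x)"
      using AE_nonneg[OF e] AE_space
    proof eventually_elim
      case (elim x)
      show ?case
      proof (cases "x e < a")
        case True
        then have "(x e)\<^sup>2 \<le> a\<^sup>2" using elim by (intro power_mono) auto
        then show ?thesis by (intro order.trans[OF ennreal_leI le_iff_add[THEN iffD2]]) auto
      next
        case False
        \<comment> \<open>The first scale above \<open>x e\<close> has index k \<ge> 1, because
          \<open>x e\<close> is at least \<open>a\<close>; the preceding scale is at most
          \<open>x e\<close>, so the term of index k - 1 alone dominates the square.\<close>
        define P where "P = (\<lambda>j::nat. x e < 2 ^ j * a)"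
        obtain m where "x e / a < 2 ^ m" using real_arch_pow[of 2 "x e / a"] by auto
        then have "P m" using a by (simp add: P_def field_simps)
        define k where "k = (LEAST j. P j)"
        have k: "P k" unfolding k_def by (rule LeastI) fact
        have "k \<noteq> 0" using k False by (auto simp: P_def intro: gr0I)
        then obtain j where j: "k = Suc j" by (cases k) auto
        then have "\<not> P j" unfolding k_def using not_less_Least[of j P] by simp
        then have ge: "2 ^ j * a \<le> x e" by (simp add: P_def)
        have "(x e)\<^sup>2 \<le> (2 ^ Suc j * a)\<^sup>2"
          using elim k by (intro power_mono) (auto simp: P_def j)
        then have "ennreal ((x e)\<^sup>2) \<le> ennreal ((2 ^ Suc j * a)\<^sup>2) * indicator (?X (2 ^ j * a)) x"
          using ge elim by (auto simp: ennreal_leI)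
        also have "\<dots> \<le> (\<Sum>j. ennreal ((2 ^ Suc j * a)\<^sup>2) * indicator (?X (2 ^ j * a)) x)"
          by (rule ennreal_le_suminf)
        finally show ?thesis by (rule order.trans) simp
      qed
    qed
  qed
  also have "\<dots> = ennreal (a\<^sup>2) + (\<Sum>j. ennreal ((2 ^ Suc j * a)\<^sup>2) * tail {e} (2 ^ j * a))"
    using X unfolding tail_def
    by (simp add: nn_integral_add nn_integral_suminf nn_integral_cmult emeasure_space_1[simplified])
  also have "(\<Sum>j. ennreal ((2 ^ Suc j * a)\<^sup>2) * tail {e} (2 ^ j * a)) \<le> (\<Sum>j. ennreal (a\<^sup>2 * (1/2) ^ Suc j))"
  proof (intro suminf_le summableI)
    fix j
    have "tail {e} (2 ^ j * a) \<le> tail {e} a ^ (2 ^ j)"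
      using e a by (intro tail_double_power) auto
    also have "\<dots> \<le> ennreal (1/8) ^ (2 ^ j)" using tail by (intro power_mono) auto
    also have "\<dots> = ennreal ((1/8) ^ (2 ^ j))" by (simp add: ennreal_power)
    \<comment> \<open>The decay is weakened to 8^-(j+1): against the factor 4^(j+1) from the squared
      scale it leaves 2^-(j+1), and these sum to 1. This is the origin of the threshold 1/8.\<close>
    also have "(1/8 :: real) ^ (2 ^ j) \<le> (1/8) ^ Suc j"
      by (rule power_decreasing) (auto simp: Suc_le_eq)
    finally have "ennreal ((2 ^ Suc j * a)\<^sup>2) * tail {e} (2 ^ j * a) \<le> ennreal ((2 ^ Suc j * a)\<^sup>2) * ennreal ((1/8) ^ Suc j)"
      by (intro mult_left_mono) (auto simp: ennreal_leI)
    also have "\<dots> = ennreal ((2 ^ Suc j * a)\<^sup>2 * (1/8) ^ Suc j)"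
      by (simp only: ennreal_mult[symmetric] zero_le_power2 zero_le_power zero_le_divide_1_iff zero_le_numeral)
    also have "(2 ^ Suc j * a)\<^sup>2 * (1/8) ^ Suc j = a\<^sup>2 * (1/2) ^ Suc j"
    proof -
      have "(2 ^ Suc j * a)\<^sup>2 * (1/8) ^ Suc j = a\<^sup>2 * (((2 * 2) ^ Suc j) * (1/8) ^ Suc j)"
        unfolding power_mult_distrib power2_eq_square by (simp add: algebra_simps)
      also have "\<dots> = a\<^sup>2 * (2 * 2 * (1/8)) ^ Suc j"
        by (simp only: power_mult_distrib)
      finally show ?thesis by simp
    qed
    finally show "ennreal ((2 ^ Suc j * a)\<^sup>2) * tail {e} (2 ^ j * a) \<le> ennreal (a\<^sup>2 * (1/2) ^ Suc j)" .
  qed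
  also have "(\<Sum>j. ennreal (a\<^sup>2 * (1/2) ^ Suc j)) = ennreal (a\<^sup>2)"
    by (rule suminf_ennreal_eq) (use sums_mult[OF power_half_series, of "a\<^sup>2"] in auto)
  also have "ennreal (a\<^sup>2) + ennreal (a\<^sup>2) = ennreal (2 * a\<^sup>2)"
    by (simp flip: ennreal_plus)
  finally show ?thesis by (simp add: add_left_mono)
qed

text \<open>Without integrability the Bochner integral in \<open>coord_sigma\<close> would default
  to 0. The upper sets shrink to the empty set, so some integer level meets the hypothesis of
  \<open>second_moment_le\<close>.\<close>

lemma second_moment_finite:
  assumes e: "e \<in> I"
  shows "integrable F (\<lambda>x. (x e)\<^sup>2)"
proof -
  let ?X = "\<lambda>n::nat. {x \<in> rspace I. \<forall>e'\<in>{e}. real n \<le> x e'}"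
  have "(\<lambda>n. prob (?X n)) \<longlonglongrightarrow> prob (\<Inter>n. ?X n)"
    using e upper_set_in_events[of "{e}"]
    by (intro finite_Lim_measure_decseq) (auto simp: decseq_def)
  also have "(\<Inter>n. ?X n) = {}"
  proof safe
    fix x assume "x \<in> (\<Inter>n. ?X n)"
    then have "real n \<le> x e" for n by auto
    moreover obtain n where "x e < real n" using reals_Archimedean2 by blast
    ultimately show "x \<in> {}" by (simp add: not_le[symmetric])
  qed
  finally have "(\<lambda>n. prob (?X n)) \<longlonglongrightarrow> 0" by simp
  then have "\<forall>\<^sub>F n in sequentially. prob (?X n) < 1/8" by (rule order_tendstoD) simp
  then have "\<forall>\<^sub>F n in sequentially. prob (?X n) < 1/8 \<and> 0 < n"
    using eventually_gt_at_top[of 0] by eventually_elim simp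
  then obtain n where n: "prob (?X n) < 1/8" "0 < n" by (auto dest: eventually_happens)
  then have "tail {e} (real n) \<le> ennreal (1/8)"
    unfolding tail_def emeasure_eq_measure by (intro ennreal_leI) simp
  then have "(\<integral>\<^sup>+x. ennreal ((x e)\<^sup>2) \<partial>F) \<le> ennreal (2 * (real n)\<^sup>2)"
    using n e by (intro second_moment_le) auto
  then have "(\<integral>\<^sup>+x. ennreal ((x e)\<^sup>2) \<partial>F) < \<infinity>" by (rule le_less_trans) simp
  then show ?thesis using e by (intro integrableI_nonneg) auto
qed

lemma coord_sigma_nonneg: "0 \<le> coord_sigma F e"
  by (simp add: coord_sigma_def)

lemma coord_sigma_square: "(coord_sigma F e)\<^sup>2 = (\<integral>x. (x e)\<^sup>2 \<partial>F)"
  by (simp add: coord_sigma_def)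

text \<open>A distribution with a density gives no mass to a coordinate hyperplane; hence no
  \<open>coord_sigma\<close> vanishes, and dividing by it is legitimate.\<close>

lemma coordinate_hyperplane_null:
  assumes e: "e \<in> I"
  shows "AE x in F. x e \<noteq> 0"
proof -
  have "emeasure (\<Pi>\<^sub>M e\<in>I. lborel) (\<Pi>\<^sub>E i\<in>I. if i = e then {0::real} else UNIV) =
      (\<Prod>i\<in>I. emeasure lborel (if i = e then {0} else UNIV :: real set))"
    using finite_I by (intro lborel_PiM.emeasure_PiM) auto
  also have "\<dots> = 0" using finite_I e by (intro prod_zero) auto
  finally have "(\<Pi>\<^sub>E i\<in>I. if i = e then {0} else UNIV) \<in> null_sets (\<Pi>\<^sub>M e\<in>I. lborel :: real measure)"
    using finite_I by (intro null_setsI sets_PiM_I_finite) auto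
  then have "AE x in (\<Pi>\<^sub>M e\<in>I. lborel). x \<notin> (\<Pi>\<^sub>E i\<in>I. if i = e then {0::real} else UNIV)"
    by (rule AE_not_in)
  then have "AE x in (\<Pi>\<^sub>M e\<in>I. lborel :: real measure). x e \<noteq> 0"
    using AE_space by eventually_elim (auto simp: PiE_iff space_PiM split: if_splits)
  then show ?thesis unfolding F_eq by (subst AE_density) auto
qed

lemma coord_sigma_pos:
  assumes e: "e \<in> I"
  shows "0 < coord_sigma F e"
proof (rule ccontr)
  assume "\<not> 0 < coord_sigma F e"
  then have "(\<integral>x. (x e)\<^sup>2 \<partial>F) = 0"
    using coord_sigma_nonneg[of e] by (simp flip: coord_sigma_square)
  then have "AE x in F. (x e)\<^sup>2 = 0"
    using integral_nonneg_eq_0_iff_AE[OF second_moment_finite[OF e]] by simp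
  with coordinate_hyperplane_null[OF e] have "AE x in F. False" by eventually_elim simp
  then show False by simp
qed

text \<open>Otherwise \<open>second_moment_le\<close> at level \<sigma>/2 would give \<sigma>^2
  \<le> \<sigma>^2/2.\<close>

lemma tail_half_sigma:
  assumes e: "e \<in> I"
  shows "ennreal (1/8) < tail {e} (coord_sigma F e / 2)"
proof (rule ccontr)
  assume "\<not> ?thesis"
  then have "(\<integral>\<^sup>+x. ennreal ((x e)\<^sup>2) \<partial>F) \<le> ennreal (2 * (coord_sigma F e / 2)\<^sup>2)"
    using coord_sigma_pos[OF e] by (intro second_moment_le e) auto
  moreover have "(\<integral>\<^sup>+x. ennreal ((x e)\<^sup>2) \<partial>F) = ennreal ((coord_sigma F e)\<^sup>2)"
    unfolding coord_sigma_square using second_moment_finite[OF e] by (intro nn_integral_eq_integral) auto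
  ultimately have "(coord_sigma F e)\<^sup>2 \<le> 2 * (coord_sigma F e / 2)\<^sup>2"
    by (simp add: ennreal_le_iff)
  then have "(coord_sigma F e)\<^sup>2 \<le> 0" by (simp add: power_divide)
  then show False using coord_sigma_pos[OF e] by simp
qed

section \<open>Mass of a single coordinate near zero\<close>

definition lower_prob :: "'i \<Rightarrow> real \<Rightarrow> real"
  where "lower_prob e t = prob {x \<in> rspace I. x e < t}"

lemma lower_set_in_events: "e \<in> I \<Longrightarrow> {x \<in> rspace I. x e < t} \<in> sets F"
proof -
  assume [measurable]: "e \<in> I"
  have "{x \<in> space F. x e < t} \<in> sets F" by measurable
  then show ?thesis by simp
qed

text \<open>Translating the slab back to the origin cannot lower the density, by
  \<open>f_shift_le\<close>.\<close>

lemma interval_prob_le: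
  assumes e: "e \<in> I" and s: "0 \<le> s"
  shows "prob {x \<in> rspace I. s \<le> x e \<and> x e < s + t} \<le> lower_prob e t"
proof -
  let ?X = "{x \<in> rspace I. s \<le> x e \<and> x e < s + t}" and ?Y = "{x \<in> rspace I. x e < t}"
  have X: "?X \<in> sets (\<Pi>\<^sub>M e\<in>I. lborel)"
  proof -
    have "{x \<in> space F. s \<le> x e \<and> x e < s + t} \<in> sets F" using e by measurable
    then show ?thesis by simp
  qed
  have "emeasure F ?X = (\<integral>\<^sup>+x. f x * indicator ?X x \<partial>(\<Pi>\<^sub>M e\<in>I. lborel))"
    by (rule emeasure_F[OF X])
  also have "\<dots> = (\<integral>\<^sup>+x. f (shift {e} s x) * indicator ?X (shift {e} s x) \<partial>(\<Pi>\<^sub>M e\<in>I. lborel))"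
    by (intro nn_integral_shift borel_measurable_times_ennreal f_measurable borel_measurable_indicator X)
  also have "\<dots> \<le> (\<integral>\<^sup>+x. f x * indicator ?Y x \<partial>(\<Pi>\<^sub>M e\<in>I. lborel))"
  proof (rule nn_integral_mono)
    fix x :: "'i \<Rightarrow> real" assume "x \<in> space (\<Pi>\<^sub>M e\<in>I. lborel)"
    then have x: "x \<in> rspace I" by (simp add: space_PiM)
    show "f (shift {e} s x) * indicator ?X (shift {e} s x) \<le> f x * indicator ?Y x"
    proof (cases "shift {e} s x \<in> ?X")
      case True
      then have "0 \<le> x e" "x e < t" using e by (auto simp: shift_def)
      then show ?thesis using True x s f_shift_le[of x "{e}" s] by simp
    qed simp
  qed
  also have "\<dots> = emeasure F ?Y"
    using lower_set_in_events[OF e, of t] unfolding sets_F by (rule emeasure_F[symmetric])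
  finally show ?thesis by (simp add: lower_prob_def emeasure_eq_measure)
qed

text \<open>The interval [0, kt) splits into k intervals of length t, of which the first carries the
  most mass.\<close>

lemma lower_prob_multiple:
  assumes e: "e \<in> I" and t: "0 \<le> t"
  shows "lower_prob e (real k * t) \<le> real k * lower_prob e t"
proof (induction k)
  case 0
  have "AE x in F. x \<notin> {x \<in> rspace I. x e < 0}"
    using AE_nonneg[OF e] by eventually_elim auto
  then have "prob {x \<in> rspace I. x e < 0} = 0"
    using lower_set_in_events[OF e, of 0] by (subst (asm) prob_eq_0[symmetric]) auto
  then show ?case by (simp add: lower_prob_def)
next
  case (Suc k)
  let ?s = "real k * t"
  have m[measurable]: "{x \<in> rspace I. ?s \<le> x e \<and> x e < ?s + t} \<in> sets F"
  proof -
    have "{x \<in> space F. ?s \<le> x e \<and> x e < ?s + t} \<in> sets F" using e by measurable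
    then show ?thesis by simp
  qed
  have "{x \<in> rspace I. x e < real (Suc k) * t} \<subseteq>
      {x \<in> rspace I. x e < ?s} \<union> {x \<in> rspace I. ?s \<le> x e \<and> x e < ?s + t}"
    by (auto simp: algebra_simps)
  then have "lower_prob e (real (Suc k) * t) \<le>
      prob ({x \<in> rspace I. x e < ?s} \<union> {x \<in> rspace I. ?s \<le> x e \<and> x e < ?s + t})"
    unfolding lower_prob_def
    by (intro finite_measure_mono sets.Un m lower_set_in_events[OF e])
  also have "\<dots> \<le> prob {x \<in> rspace I. x e < ?s} + prob {x \<in> rspace I. ?s \<le> x e \<and> x e < ?s + t}"
    by (intro measure_Un_le m lower_set_in_events[OF e])
  also have "\<dots> \<le> real k * lower_prob e t + lower_prob e t"
    using Suc interval_prob_le[OF e, of ?s t] t by (intro add_mono) (auto simp: lower_prob_def)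
  finally show ?case by (simp add: algebra_simps)
qed

text \<open>Markov's inequality leaves mass at least 3/4 below 2\<sigma>. At most 2\<sigma>/t + 1
  \<le> 3\<sigma>/t intervals of length t cover that range, so the first has mass at least (3/4) /
  (3\<sigma>/t). The bound \<sigma> is separate from \<open>coord_sigma\<close> so that one value
  serves all coordinates.\<close>

lemma lower_prob_ge:
  assumes e: "e \<in> I" and \<sigma>: "coord_sigma F e \<le> \<sigma>" and t: "0 < t" "t \<le> \<sigma>"
  shows "t / (4 * \<sigma>) \<le> lower_prob e t"
proof -
  have \<sigma>_pos: "0 < \<sigma>" using t by simp
  have meas: "{x \<in> rspace I. (2 * \<sigma>)\<^sup>2 \<le> (x e)\<^sup>2} \<in> sets F"
  proof -
    have "{x \<in> space F. (2 * \<sigma>)\<^sup>2 \<le> (x e)\<^sup>2} \<in> sets F" using e by measurable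
    then show ?thesis by simp
  qed
  have "prob {x \<in> rspace I. (2 * \<sigma>)\<^sup>2 \<le> (x e)\<^sup>2} \<le> (\<integral>x. (x e)\<^sup>2 \<partial>F) / (2 * \<sigma>)\<^sup>2"
    using integral_Markov_inequality_measure[OF second_moment_finite[OF e] sets.top, of "(2 * \<sigma>)\<^sup>2"] \<sigma>_pos
    by simp
  also have "\<dots> \<le> \<sigma>\<^sup>2 / (2 * \<sigma>)\<^sup>2"
    using \<sigma> coord_sigma_nonneg[of e] unfolding coord_sigma_square[symmetric]
    by (intro divide_right_mono power_mono) auto
  also have "\<dots> = 1 / 4" using \<sigma>_pos by (simp add: power2_eq_square)
  finally have far: "prob {x \<in> rspace I. (2 * \<sigma>)\<^sup>2 \<le> (x e)\<^sup>2} \<le> 1 / 4" .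
  define k where "k = nat \<lceil>2 * \<sigma> / t\<rceil>"
  have "real k = of_int \<lceil>2 * \<sigma> / t\<rceil>" using t \<sigma>_pos by (simp add: k_def)
  then have k: "2 * \<sigma> / t \<le> real k" "real k \<le> 2 * \<sigma> / t + 1" by linarith+
  have "1 = prob (rspace I)" using prob_space by simp
  also have "\<dots> \<le> prob ({x \<in> rspace I. x e < real k * t} \<union> {x \<in> rspace I. (2 * \<sigma>)\<^sup>2 \<le> (x e)\<^sup>2})"
  proof (intro finite_measure_mono sets.Un meas lower_set_in_events e subsetI)
    fix x assume "x \<in> rspace I"
    moreover have "(2 * \<sigma>)\<^sup>2 \<le> (x e)\<^sup>2" if "\<not> x e < real k * t"
    proof -
      have "2 * \<sigma> \<le> real k * t" using k t by (simp add: field_simps)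
      with that show ?thesis using \<sigma>_pos by (intro power_mono) auto
    qed
    ultimately show "x \<in> {x \<in> rspace I. x e < real k * t} \<union> {x \<in> rspace I. (2 * \<sigma>)\<^sup>2 \<le> (x e)\<^sup>2}"
      by auto
  qed
  also have "\<dots> \<le> lower_prob e (real k * t) + prob {x \<in> rspace I. (2 * \<sigma>)\<^sup>2 \<le> (x e)\<^sup>2}"
    unfolding lower_prob_def by (intro measure_Un_le meas lower_set_in_events e)
  also have "\<dots> \<le> real k * lower_prob e t + 1 / 4"
    using t by (intro add_mono far lower_prob_multiple e) auto
  finally have 1: "3 / 4 \<le> real k * lower_prob e t" by simp
  have "real k \<le> 3 * \<sigma> / t" using k(2) t by (simp add: field_simps)
  then have "real k * lower_prob e t \<le> 3 * \<sigma> / t * lower_prob e t"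
    by (intro mult_right_mono) (auto simp: lower_prob_def)
  with 1 have "3 / 4 \<le> 3 * \<sigma> / t * lower_prob e t" by linarith
  then show ?thesis using t \<sigma>_pos by (simp add: field_simps)
qed

end

section \<open>Small and large values of the coordinates\<close>

text \<open>With midpoints only, repeated halving from \<open>y\<close> towards \<open>x\<close>
  reaches the fractions 2^-j; these suffice as step sizes tending to 0.\<close>

lemma midpoint_closed_segment:
  assumes mid: "\<And>x y. x \<in> K \<Longrightarrow> y \<in> K \<Longrightarrow> coord_midpoint S x y \<in> K" and K: "K \<subseteq> rspace S"
    and x: "x \<in> K" and y: "y \<in> K"
  shows "(\<lambda>e\<in>S. x e + (1/2) ^ j * (y e - x e)) \<in> K"
proof (induction j)
  case 0
  have "(\<lambda>e\<in>S. x e + (1/2) ^ 0 * (y e - x e)) = y"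
    using y K by (auto simp: fun_eq_iff PiE_iff extensional_def)
  then show ?case using y by simp
next
  case (Suc j)
  have "(\<lambda>e\<in>S. x e + (1/2) ^ Suc j * (y e - x e)) = coord_midpoint S x (\<lambda>e\<in>S. x e + (1/2) ^ j * (y e - x e))"
    by (auto simp: coord_midpoint_def fun_eq_iff)
  then show ?case using mid[OF x Suc] by (simp only:)
qed

text \<open>A substitute for the mean of \<open>Y\<close> lying in the closure of \<open>K\<close> that avoids separation theorems: a
  Frank-Wolfe step from \<open>x\<close> towards \<open>Y \<omega>\<close> decreases, on average over \<open>\<omega>\<close>, the squared distance \<open>D x\<close>
  to the set of points with all coordinates at least \<open>q / 2\<close>, so the infimum of \<open>D\<close> on \<open>K\<close> is zero.\<close>

lemma (in prob_space) exists_point_above_quarter_mean: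
  fixes Y :: "'a \<Rightarrow> 'i \<Rightarrow> real" and K :: "('i \<Rightarrow> real) set"
  assumes S: "finite S" and E[measurable]: "E \<in> events" and q: "0 < q" and "K \<noteq> {}"
    and K: "K \<subseteq> S \<rightarrow>\<^sub>E {0..1}"
    and mid: "\<And>x y. x \<in> K \<Longrightarrow> y \<in> K \<Longrightarrow> coord_midpoint S x y \<in> K"
    and Y[measurable]: "\<And>e. e \<in> S \<Longrightarrow> (\<lambda>\<omega>. Y \<omega> e) \<in> borel_measurable M"
    and YK: "\<And>\<omega>. \<omega> \<in> E \<Longrightarrow> Y \<omega> \<in> K"
    and mean: "\<And>e. e \<in> S \<Longrightarrow> q \<le> expectation (\<lambda>\<omega>. Y \<omega> e * indicator E \<omega>)"
  shows "\<exists>x\<in>K. \<forall>e\<in>S. q / 4 \<le> x e"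
proof -
  \<comment> \<open>The target q/2 leaves a margin of q/4: the infimum zero of \<open>D\<close> need
    not be attained, and a point with \<open>D\<close> below (q/4)^2 misses the target by less than
    q/4.\<close>
  define b where "b = q / 2"
  define D where "D = (\<lambda>x. \<Sum>e\<in>S. (max 0 (b - x e))\<^sup>2)"
  define d where "d = Inf (D ` K)"
  have D_nonneg: "0 \<le> D x" for x by (simp add: D_def sum_nonneg)
  then have bdd: "bdd_below (D ` K)" by (intro bdd_belowI[of _ 0]) auto
  have d_le: "d \<le> D x" if "x \<in> K" for x
    unfolding d_def using bdd that by (intro cInf_lower) auto
  have d_approx: "\<exists>x\<in>K. D x < d + \<epsilon>" if "0 < \<epsilon>" for \<epsilon>
    using cInf_lessD[of "D ` K" "d + \<epsilon>"] that \<open>K \<noteq> {}\<close> by (auto simp: d_def)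
  have step: "d \<le> (1 - 2 * t) * D x + t\<^sup>2 * card S" if x: "x \<in> K" and t: "t = (1/2) ^ j" for x t j
  proof -
    define w where "w = (\<lambda>e. max 0 (b - x e))"
    \<comment> \<open>Off \<open>E\<close> the displacement is zero, so the moved point stays in
      \<open>K\<close> for every \<omega>, although \<open>Y\<close> is known to lie in
      \<open>K\<close> only on \<open>E\<close>.\<close>
    define \<Delta> where "\<Delta> = (\<lambda>e \<omega>. (Y \<omega> e - x e) * indicator E \<omega>)"
    have x01: "0 \<le> x e" "x e \<le> 1" if "e \<in> S" for e using K x that by (auto simp: PiE_iff)
    have Y01: "0 \<le> Y \<omega> e" "Y \<omega> e \<le> 1" if "e \<in> S" "\<omega> \<in> E" for e \<omega>
      using K YK[OF that(2)] that(1) by (auto simp: PiE_iff)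
    have \<Delta>1: "\<bar>\<Delta> e \<omega>\<bar> \<le> 1" if "e \<in> S" for e \<omega>
      using x01[OF that] Y01[OF that, of \<omega>] by (auto simp: \<Delta>_def indicator_def)
    have [measurable]: "\<Delta> e \<in> borel_measurable M" if "e \<in> S" for e
      using that by (simp add: \<Delta>_def)
    have int: "integrable M (\<Delta> e)" if "e \<in> S" for e
      using \<Delta>1[OF that] that by (intro integrable_const_bound[where B = 1]) auto
    have intY: "integrable M (\<lambda>\<omega>. Y \<omega> e * indicator E \<omega>)" if "e \<in> S" for e
      using Y01[OF that] that
      by (intro integrable_const_bound[where B = 1]) (auto simp: indicator_def)
    \<comment> \<open>The mean displacement of coordinate e is at least q - x e, hence at least the
      deficit \<open>w e\<close> whenever x e \<le> b; otherwise the deficit is zero.\<close>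
    have drift: "(w e)\<^sup>2 \<le> w e * expectation (\<Delta> e)" if e: "e \<in> S" for e
    proof -
      have "expectation (\<Delta> e) = expectation (\<lambda>\<omega>. Y \<omega> e * indicator E \<omega> - x e * indicator E \<omega>)"
        by (simp add: \<Delta>_def algebra_simps)
      also have "\<dots> = expectation (\<lambda>\<omega>. Y \<omega> e * indicator E \<omega>) - x e * prob E"
        using intY[OF e] by (subst Bochner_Integration.integral_diff) (auto simp: emeasure_eq_measure)
      also have "\<dots> \<ge> q - x e"
        using mean[OF e] x01[OF e] mult_left_le[of "prob E" "x e"] by simp
      finally have "q - x e \<le> expectation (\<Delta> e)" .
      then have "w e \<le> expectation (\<Delta> e)" if "x e \<le> b"
        using that q by (simp add: w_def b_def)
      then have "w e * w e \<le> w e * expectation (\<Delta> e)"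
        by (cases "x e \<le> b") (auto simp: w_def intro: mult_left_mono)
      then show ?thesis by (simp add: power2_eq_square)
    qed
    have pointwise: "d \<le> (\<Sum>e\<in>S. (w e)\<^sup>2 - 2 * t * w e * \<Delta> e \<omega> + t\<^sup>2)" for \<omega>
    proof -
      have "(\<lambda>e\<in>S. x e + t * \<Delta> e \<omega>) \<in> K"
      proof (cases "\<omega> \<in> E")
        case True
        then have "(\<lambda>e\<in>S. x e + t * \<Delta> e \<omega>) = (\<lambda>e\<in>S. x e + (1/2) ^ j * (Y \<omega> e - x e))"
          by (simp add: \<Delta>_def t)
        also have "\<dots> \<in> K"
          using mid K x YK[OF True] by (intro midpoint_closed_segment) auto
        finally show ?thesis .
      next
        case False
        then have "(\<lambda>e\<in>S. x e + t * \<Delta> e \<omega>) = x"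
          using x K by (auto simp: \<Delta>_def fun_eq_iff PiE_iff extensional_def)
        then show ?thesis using x by simp
      qed
      then have "d \<le> D (\<lambda>e\<in>S. x e + t * \<Delta> e \<omega>)" by (rule d_le)
      also have "\<dots> \<le> (\<Sum>e\<in>S. (w e)\<^sup>2 - 2 * t * w e * \<Delta> e \<omega> + t\<^sup>2)"
        unfolding D_def
      proof (rule sum_mono)
        fix e assume e: "e \<in> S"
        \<comment> \<open>The squared positive part has derivative 2 max(0, r) and lies below its
          quadratic expansion with error term h^2.\<close>
        have smooth: "(max 0 (r - h))\<^sup>2 \<le> (max 0 r)\<^sup>2 - 2 * max 0 r * h + h\<^sup>2" for r h :: real
        proof (cases "0 \<le> r")
          case True
          have "(max 0 (r - h))\<^sup>2 \<le> \<bar>r - h\<bar>\<^sup>2" by (intro power_mono) auto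
          also have "\<dots> = (max 0 r)\<^sup>2 - 2 * max 0 r * h + h\<^sup>2"
            using True by (simp add: power2_diff max_absorb2)
          finally show ?thesis .
        next
          case False
          have "(max 0 (r - h))\<^sup>2 \<le> \<bar>h\<bar>\<^sup>2" using False by (intro power_mono) auto
          then show ?thesis using False by simp
        qed
        have "(max 0 (b - (\<lambda>e\<in>S. x e + t * \<Delta> e \<omega>) e))\<^sup>2 \<le> (w e)\<^sup>2 - 2 * w e * (t * \<Delta> e \<omega>) + (t * \<Delta> e \<omega>)\<^sup>2"
          using smooth[of "b - x e" "t * \<Delta> e \<omega>"] e by (simp add: w_def algebra_simps)
        also have "(t * \<Delta> e \<omega>)\<^sup>2 \<le> t\<^sup>2"
          using \<Delta>1[OF e, of \<omega>] mult_left_le[of "(\<Delta> e \<omega>)\<^sup>2" "t\<^sup>2"]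
          by (simp add: power_mult_distrib abs_square_le_1)
        finally show "(max 0 (b - (\<lambda>e\<in>S. x e + t * \<Delta> e \<omega>) e))\<^sup>2 \<le> (w e)\<^sup>2 - 2 * t * w e * \<Delta> e \<omega> + t\<^sup>2"
          by (simp add: algebra_simps)
      qed
      finally show ?thesis .
    qed
    have int2: "integrable M (\<lambda>\<omega>. (w e)\<^sup>2 - 2 * t * w e * \<Delta> e \<omega> + t\<^sup>2)" if "e \<in> S" for e
      using int[OF that] by auto
    have "d = expectation (\<lambda>_. d)" using prob_space by simp
    also have "\<dots> \<le> expectation (\<lambda>\<omega>. \<Sum>e\<in>S. (w e)\<^sup>2 - 2 * t * w e * \<Delta> e \<omega> + t\<^sup>2)"
      using int2 pointwise by (intro integral_mono Bochner_Integration.integrable_sum) auto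
    also have "\<dots> = (\<Sum>e\<in>S. expectation (\<lambda>\<omega>. (w e)\<^sup>2 - 2 * t * w e * \<Delta> e \<omega> + t\<^sup>2))"
      using int2 by (intro Bochner_Integration.integral_sum) auto
    also have "\<dots> = (\<Sum>e\<in>S. (w e)\<^sup>2 - 2 * t * (w e * expectation (\<Delta> e)) + t\<^sup>2)"
      using int by (intro sum.cong) (simp_all add: prob_space mult.assoc)
    also have "\<dots> \<le> (\<Sum>e\<in>S. (1 - 2 * t) * (w e)\<^sup>2 + t\<^sup>2)"
    proof (rule sum_mono)
      fix e assume "e \<in> S"
      then have "2 * t * (w e)\<^sup>2 \<le> 2 * t * (w e * expectation (\<Delta> e))"
        using drift t by (intro mult_left_mono) auto
      then show "(w e)\<^sup>2 - 2 * t * (w e * expectation (\<Delta> e)) + t\<^sup>2 \<le> (1 - 2 * t) * (w e)\<^sup>2 + t\<^sup>2"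
        by (simp add: algebra_simps)
    qed
    also have "\<dots> = (1 - 2 * t) * D x + t\<^sup>2 * card S"
      by (simp add: D_def w_def sum.distrib sum_distrib_left)
    finally show ?thesis .
  qed
  \<comment> \<open>For a nearly minimal \<open>x\<close>, one step gives d \<le> (1 - 2t) d + t^2
    |S|, that is 2d \<le> t |S|. The exponent \<open>Suc j\<close> keeps 1 - 2t nonnegative.\<close>
  have small: "d \<le> card S * (1/2) ^ Suc j" for j
  proof -
    define t :: real where "t = (1/2) ^ Suc j"
    have t: "0 < t" "2 * t \<le> 1" by (auto simp: t_def power_le_one)
    have "d \<le> (1 - 2 * t) * d + t\<^sup>2 * card S + \<epsilon>" if \<epsilon>: "0 < \<epsilon>" for \<epsilon>
    proof -
      obtain x where x: "x \<in> K" "D x < d + \<epsilon>" using d_approx[OF \<epsilon>] by auto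
      have "d \<le> (1 - 2 * t) * D x + t\<^sup>2 * card S" by (rule step[OF x(1) t_def])
      also have "(1 - 2 * t) * D x \<le> (1 - 2 * t) * (d + \<epsilon>)"
        using t x by (intro mult_left_mono) auto
      also have "\<dots> \<le> (1 - 2 * t) * d + \<epsilon>" using t \<epsilon> by (simp add: algebra_simps)
      finally show ?thesis by simp
    qed
    then have "d \<le> (1 - 2 * t) * d + t\<^sup>2 * card S" by (rule field_le_epsilon)
    then have "2 * d * t \<le> (t * card S) * t" by (simp add: power2_eq_square algebra_simps)
    then have "2 * d \<le> t * card S" using t by (simp only: mult_le_cancel_right_pos)
    moreover have "0 \<le> t * card S" using t by simp
    ultimately have "d \<le> t * card S" by linarith
    then show ?thesis by (simp add: t_def algebra_simps)
  qed
  have "(\<lambda>j. card S * (1/2::real) ^ Suc j) \<longlonglongrightarrow> 0"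
    using tendsto_mult_right_zero[OF LIMSEQ_Suc[OF LIMSEQ_power_zero[of "1/2::real"]]] by simp
  then have "d \<le> 0" by (rule LIMSEQ_le_const) (use small in blast)
  have "0 < (q / 4)\<^sup>2" using q by simp
  then obtain x where x: "x \<in> K" "D x < d + (q / 4)\<^sup>2"
    using d_approx by blast
  then have D_small: "D x < (q / 4)\<^sup>2" using \<open>d \<le> 0\<close> by linarith
  have "q / 4 \<le> x e" if e: "e \<in> S" for e
  proof -
    have "(max 0 (b - x e))\<^sup>2 \<le> D x"
      unfolding D_def using S e member_le_sum[of e S "\<lambda>e. (max 0 (b - x e))\<^sup>2"] by simp
    then have "(max 0 (b - x e))\<^sup>2 < (q / 4)\<^sup>2" using D_small by (rule le_less_trans)
    then have "max 0 (b - x e) < q / 4" by (rule power2_less_imp_less) (use q in simp)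
    then show ?thesis unfolding b_def by linarith
  qed
  then show ?thesis using x by auto
qed

section \<open>The density at the origin and small boxes\<close>

context decreasing_logconcave
begin

abbreviation f_max :: ennreal
  where "f_max \<equiv> f (\<lambda>e\<in>I. 0)"

lemma zero_in_orthant: "(\<lambda>e\<in>I. 0) \<in> orthant I"
  by auto

lemma f_le_f_max: "x \<in> rspace I \<Longrightarrow> f x \<le> f_max"
  using f_zero[of x] f_antimono[OF zero_in_orthant, of x] by (cases "x \<in> orthant I") (auto simp: PiE_iff)

text \<open>Where \<open>f x < \<rho>\<^sup>2 * f 0\<close>, the inequality \<open>f x * f 0 \<le> (f (x / 2))\<^sup>2\<close> gives \<open>f x \<le> \<rho> * f (x / 2)\<close>,
  and \<open>f (x / 2)\<close> has integral \<open>2 ^ card I\<close>.\<close>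

lemma low_density_prob:
  assumes \<rho>: "0 \<le> \<rho>"
  shows "emeasure F {x \<in> rspace I. f x < (ennreal \<rho>)\<^sup>2 * f_max} \<le> ennreal (\<rho> * 2 ^ card I)"
proof -
  let ?B = "{x \<in> rspace I. f x < (ennreal \<rho>)\<^sup>2 * f_max}"
  have "{x \<in> space (\<Pi>\<^sub>M e\<in>I. lborel). f x < (ennreal \<rho>)\<^sup>2 * f_max} \<in> sets (\<Pi>\<^sub>M e\<in>I. lborel)" by measurable
  then have B: "?B \<in> sets (\<Pi>\<^sub>M e\<in>I. lborel)" by (simp add: space_PiM)
  define half where "half = (\<lambda>x. \<lambda>e\<in>I. 0 + (1/2) * x e :: real)"
  have [measurable]: "half \<in> measurable (\<Pi>\<^sub>M e\<in>I. lborel) (\<Pi>\<^sub>M e\<in>I. lborel)"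
    unfolding half_def by measurable
  have halving: "ennreal (1/2) ^ card I * (\<integral>\<^sup>+x. f (half x) \<partial>(\<Pi>\<^sub>M e\<in>I. lborel)) = 1"
    using nn_integral_PiM_lborel_affine[OF finite_I f_measurable, of "1/2" "\<lambda>_. 0"]
    unfolding half_def total by (metis half_gt_zero zero_less_one)
  have "ennreal (2 ^ card I) = ennreal (2 ^ card I) * (ennreal (1/2) ^ card I * (\<integral>\<^sup>+x. f (half x) \<partial>(\<Pi>\<^sub>M e\<in>I. lborel)))"
    unfolding halving by simp
  also have "\<dots> = ennreal (2 ^ card I * (1/2) ^ card I) * (\<integral>\<^sup>+x. f (half x) \<partial>(\<Pi>\<^sub>M e\<in>I. lborel))"
    by (simp only: ennreal_mult zero_le_power zero_le_numeral zero_le_divide_1_iff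
        ennreal_power mult.assoc)
  also have "(2::real) ^ card I * (1/2) ^ card I = 1" by (simp flip: power_mult_distrib)
  finally have half_total: "(\<integral>\<^sup>+x. f (half x) \<partial>(\<Pi>\<^sub>M e\<in>I. lborel)) = ennreal (2 ^ card I)" by simp
  have "emeasure F ?B = (\<integral>\<^sup>+x. f x * indicator ?B x \<partial>(\<Pi>\<^sub>M e\<in>I. lborel))"
    by (rule emeasure_F[OF B])
  also have "\<dots> \<le> (\<integral>\<^sup>+x. ennreal \<rho> * f (half x) \<partial>(\<Pi>\<^sub>M e\<in>I. lborel))"
  proof (rule nn_integral_mono)
    fix x :: "'i \<Rightarrow> real" assume "x \<in> space (\<Pi>\<^sub>M e\<in>I. lborel)"
    then have x: "x \<in> rspace I" by (simp add: space_PiM)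
    have "f x \<le> ennreal \<rho> * f (half x)" if lt: "f x < (ennreal \<rho>)\<^sup>2 * f_max"
    proof (cases "x \<in> orthant I")
      case True
      have "coord_midpoint I x (\<lambda>e\<in>I. 0) = half x"
        by (auto simp: coord_midpoint_def half_def fun_eq_iff)
      then have mid: "f x * f_max \<le> (f (half x))\<^sup>2"
        using midpoint_logconcave[OF True zero_in_orthant] by simp
      have "(f x)\<^sup>2 \<le> ((ennreal \<rho>)\<^sup>2 * f_max) * f x"
        using lt by (simp add: power2_eq_square mult_right_mono)
      also have "\<dots> \<le> (ennreal \<rho>)\<^sup>2 * (f (half x))\<^sup>2"
        using mid by (simp add: mult.assoc mult.commute[of f_max] mult_left_mono)
      finally have "(f x)\<^sup>2 \<le> (ennreal \<rho> * f (half x))\<^sup>2" by (simp add: power_mult_distrib)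
      then show ?thesis by (rule power2_le_imp_le_ennreal)
    next
      case False
      then show ?thesis using x by (simp add: f_zero)
    qed
    then show "f x * indicator ?B x \<le> ennreal \<rho> * f (half x)"
      by (auto simp: indicator_def)
  qed
  also have "\<dots> = ennreal \<rho> * (\<integral>\<^sup>+x. f (half x) \<partial>(\<Pi>\<^sub>M e\<in>I. lborel))"
    by (rule nn_integral_cmult) measurable
  also have "\<dots> = ennreal (\<rho> * 2 ^ card I)"
    using \<rho> half_total by (simp add: ennreal_mult)
  finally show ?thesis .
qed


text \<open>The set \<open>E\<close> of density at least \<rho>^2 f(0) misses mass at most 1/16.
  Truncating coordinate e at a e and dividing by a e gives a variable in [0,1] that equals 1 with
  probability at least 1/8, so its mean over \<open>E\<close> is at least 1/8 - 1/16 = 1/16. As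
  \<open>E\<close> is midpoint closed, a quarter of this, 1/64, is reached in all coordinates at
  once.\<close>

lemma exists_high_density_corner:
  assumes a: "\<And>e. e \<in> I \<Longrightarrow> 0 < a e" "\<And>e. e \<in> I \<Longrightarrow> ennreal (1/8) \<le> tail {e} (a e)"
  shows "\<exists>x\<in>orthant I. (\<forall>e\<in>I. a e / 64 \<le> x e) \<and> (ennreal (1 / (16 * 2 ^ card I)))\<^sup>2 * f_max \<le> f x"
proof -
  define \<rho> :: real where "\<rho> = 1 / (16 * 2 ^ card I)"
  have "(1::real) \<le> 2 ^ card I" by simp
  then have "(1::real) \<le> 16 * 2 ^ card I" by linarith
  then have \<rho>: "0 \<le> \<rho>" "\<rho> \<le> 1" "\<rho> * 2 ^ card I = 1/16"
    by (simp_all add: \<rho>_def divide_le_eq_1)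
  define \<tau> where "\<tau> = (ennreal \<rho>)\<^sup>2 * f_max"
  define E where "E = {x \<in> orthant I. \<tau> \<le> f x}"
  define C where "C = {y \<in> I \<rightarrow>\<^sub>E {0..1}. (\<lambda>e\<in>I. a e * y e) \<in> E}"
  \<comment> \<open>Cutting a point of \<open>E\<close> down to the bounds \<open>a e\<close> keeps
    it in \<open>E\<close>, since \<open>f\<close> is decreasing.\<close>
  define Y where "Y = (\<lambda>x. \<lambda>e\<in>I. min (x e) (a e) / a e)"
  have E_sets: "E \<in> sets F"
  proof -
    have "{x \<in> space (\<Pi>\<^sub>M e\<in>I. lborel). \<tau> \<le> f x} \<inter> orthant I \<in> sets (\<Pi>\<^sub>M e\<in>I. lborel)"
      by (rule sets.Int[OF _ orthant_sets]) measurable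
    also have "{x \<in> space (\<Pi>\<^sub>M e\<in>I. lborel). \<tau> \<le> f x} \<inter> orthant I = E"
      using orthant_subset_rspace by (auto simp: E_def space_PiM)
    finally show ?thesis by simp
  qed
  have E_prob: "prob (rspace I - E) \<le> 1/16"
  proof -
    let ?B = "{x \<in> rspace I. f x < (ennreal \<rho>)\<^sup>2 * f_max}"
    have B: "?B \<in> sets F"
    proof -
      have "{x \<in> space (\<Pi>\<^sub>M e\<in>I. lborel). f x < (ennreal \<rho>)\<^sup>2 * f_max} \<in> sets (\<Pi>\<^sub>M e\<in>I. lborel)" by measurable
      then show ?thesis by (simp add: space_PiM)
    qed
    have "AE x in F. x \<in> rspace I - E \<longrightarrow> x \<in> ?B"
      using AE_orthant by eventually_elim (auto simp: E_def \<tau>_def)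
    then have "emeasure F (rspace I - E) \<le> emeasure F ?B"
      by (intro emeasure_mono_AE B) auto
    also have "\<dots> \<le> ennreal (1/16)" using low_density_prob[OF \<rho>(1)] \<rho>(3) by simp
    finally show ?thesis by (simp add: emeasure_eq_measure ennreal_le_iff)
  qed
  have "\<exists>y\<in>C. \<forall>e\<in>I. (1/16) / 4 \<le> y e"
  proof (rule exists_point_above_quarter_mean[where E = E and Y = Y])
    have "(\<lambda>e\<in>I. a e * (\<lambda>e\<in>I. 0) e) = (\<lambda>e\<in>I. 0)" by (auto simp: fun_eq_iff)
    moreover have "\<tau> \<le> f_max"
      using mult_right_mono[of "(ennreal \<rho>)\<^sup>2" 1 f_max] \<rho> 
      by (simp add: \<tau>_def ennreal_power power_le_one)
    ultimately have "(\<lambda>e\<in>I. 0) \<in> C" by (auto simp: C_def E_def)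
    then show "C \<noteq> {}" by auto
    show "C \<subseteq> I \<rightarrow>\<^sub>E {0..1}" by (auto simp: C_def)
    show "coord_midpoint I x y \<in> C" if "x \<in> C" "y \<in> C" for x y
    proof -
      let ?x = "\<lambda>e\<in>I. a e * x e" and ?y = "\<lambda>e\<in>I. a e * y e"
      have xy: "?x \<in> E" "?y \<in> E" using that by (auto simp: C_def)
      then have "\<tau>\<^sup>2 \<le> f ?x * f ?y" by (auto simp: E_def power2_eq_square intro: mult_mono)
      also have "\<dots> \<le> (f (coord_midpoint I ?x ?y))\<^sup>2" using xy by (intro midpoint_logconcave) (auto simp: E_def)
      finally have "\<tau> \<le> f (coord_midpoint I ?x ?y)" by (rule power2_le_imp_le_ennreal)
      moreover have "coord_midpoint I ?x ?y \<in> orthant I"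
        using xy unfolding E_def by (intro coord_midpoint_in_orthant) blast+
      ultimately have "coord_midpoint I ?x ?y \<in> E"
        unfolding E_def by blast
      also have "coord_midpoint I ?x ?y = (\<lambda>e\<in>I. a e * coord_midpoint I x y e)"
        by (auto simp: coord_midpoint_def fun_eq_iff algebra_simps)
      finally have "(\<lambda>e\<in>I. a e * coord_midpoint I x y e) \<in> E" .
      moreover have "coord_midpoint I x y e \<in> {0..1}" if "e \<in> I" for e
      proof -
        have "x e \<in> {0..1}" "y e \<in> {0..1}"
          using \<open>x \<in> C\<close> \<open>y \<in> C\<close> that unfolding C_def by blast+
        then show ?thesis using that by (simp add: coord_midpoint_def)
      qed
      moreover have "coord_midpoint I x y \<in> extensional I" by (simp add: coord_midpoint_def)
      ultimately show ?thesis unfolding C_def PiE_iff by blast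
    qed
    show "(\<lambda>\<omega>. Y \<omega> e) \<in> borel_measurable F" if e: "e \<in> I" for e
    proof -
      have "(\<lambda>\<omega>. min (\<omega> e) (a e) / a e) \<in> borel_measurable F" using e by measurable
      then show ?thesis using e by (simp add: Y_def)
    qed
    show "Y \<omega> \<in> C" if \<omega>: "\<omega> \<in> E" for \<omega>
    proof -
      have 1: "\<omega> \<in> orthant I" "\<tau> \<le> f \<omega>" using \<omega> by (auto simp: E_def)
      have 2: "(\<lambda>e\<in>I. a e * Y \<omega> e) = (\<lambda>e\<in>I. min (\<omega> e) (a e))"
        using a(1) by (force simp: Y_def fun_eq_iff)
      have 3: "(\<lambda>e\<in>I. min (\<omega> e) (a e)) \<in> orthant I"
        using 1 a(1) by (auto simp: PiE_iff less_imp_le)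
      have "f \<omega> \<le> f (\<lambda>e\<in>I. min (\<omega> e) (a e))"
        using 1 3 by (intro f_antimono) auto
      then have "(\<lambda>e\<in>I. a e * Y \<omega> e) \<in> E"
        unfolding 2 using 1 3 by (auto simp: E_def)
      moreover have "Y \<omega> \<in> I \<rightarrow>\<^sub>E {0..1}"
        using 1 a(1) by (auto simp: Y_def PiE_iff less_imp_le divide_le_eq_1)
      ultimately show ?thesis by (simp add: C_def)
    qed
    show "1/16 \<le> expectation (\<lambda>\<omega>. Y \<omega> e * indicator E \<omega>)" if e: "e \<in> I" for e
    proof -
      let ?U = "{x \<in> rspace I. \<forall>e'\<in>{e}. a e \<le> x e'}"
      have U: "?U \<in> sets F" using e by (intro upper_set_in_events) auto
      have "ennreal (1/8) \<le> ennreal (prob ?U)"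
        using a(2)[OF e] by (simp add: tail_def emeasure_eq_measure)
      then have "1/8 \<le> prob ?U" by (simp add: ennreal_le_iff)
      also have "prob ?U \<le> prob ((?U \<inter> E) \<union> (rspace I - E))"
        using U E_sets sets.compl_sets[OF E_sets] by (intro finite_measure_mono sets.Un sets.Int) auto
      also have "\<dots> \<le> prob (?U \<inter> E) + prob (rspace I - E)"
        using U E_sets sets.compl_sets[OF E_sets] by (intro measure_Un_le sets.Int) auto
      finally have "1/16 \<le> prob (?U \<inter> E)" using E_prob by simp
      also have "prob (?U \<inter> E) = expectation (indicator (?U \<inter> E))"
      proof -
        have "?U \<inter> E \<inter> space F = ?U \<inter> E" unfolding space_F by blast
        then show ?thesis using U E_sets by (subst Bochner_Integration.integral_indicator) (simp only:)
      qed
      also have "\<dots> \<le> expectation (\<lambda>\<omega>. Y \<omega> e * indicator E \<omega>)"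
      proof (rule integral_mono)
        show "integrable F (indicator (?U \<inter> E) :: _ \<Rightarrow> real)"
          using U E_sets by (simp add: emeasure_eq_measure)
        have 1: "\<bar>Y \<omega> e * indicator E \<omega>\<bar> \<le> 1" for \<omega>
          using a(1)[OF e] e by (auto simp: Y_def indicator_def E_def PiE_iff divide_le_eq_1)
        have [measurable]: "(\<lambda>\<omega>. min (\<omega> e) (a e) / a e) \<in> borel_measurable F" using e by measurable
        then have "(\<lambda>\<omega>. Y \<omega> e) \<in> borel_measurable F" using e by (simp add: Y_def)
        then show "integrable F (\<lambda>\<omega>. Y \<omega> e * indicator E \<omega>)"
          using 1 E_sets by (intro integrable_const_bound[where B = 1]) auto
        show "indicator (?U \<inter> E) \<omega> \<le> Y \<omega> e * indicator E \<omega>" if "\<omega> \<in> space F" for \<omega>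
          using a(1)[OF e] e by (auto simp: Y_def indicator_def E_def PiE_iff)
      qed
      finally show ?thesis .
    qed
  qed (use finite_I E_sets in auto)
  then obtain y where y: "y \<in> C" "\<And>e. e \<in> I \<Longrightarrow> 1/64 \<le> y e" by auto
  let ?x = "\<lambda>e\<in>I. a e * y e"
  have "?x \<in> E" using y by (simp add: C_def)
  moreover have "a e / 64 \<le> ?x e" if "e \<in> I" for e
    using mult_left_mono[OF y(2)[OF that], of "a e"] a(1)[OF that] that by simp
  ultimately show ?thesis by (intro bexI[of _ ?x]) (auto simp: E_def \<tau>_def \<rho>_def)
qed


text \<open>Below the point z the density is at least \<rho>^2 f(0), so total mass one bounds f(0)
  by the reciprocal of \<rho>^2 times the volume of a box; then f(0) p^|I| bounds the probability.
  In the constants, 256 = 16^2 and 512 = 4 * 64 * 2, from the factor 4^|I| in 1/\<rho>^2, from the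
  sides a e / 64, and from a e being half of \<open>coord_sigma F e\<close>.\<close>

lemma box_prob_le:
  assumes p: "0 \<le> p"
  shows "prob {x \<in> rspace I. \<forall>e\<in>I. x e \<le> p} \<le> 256 * (\<Prod>e\<in>I. 512 * p / coord_sigma F e)"
proof -
  define a where "a = (\<lambda>e. coord_sigma F e / 2)"
  have a_pos: "0 < a e" if "e \<in> I" for e using coord_sigma_pos[OF that] by (simp add: a_def)
  define \<rho> :: real where "\<rho> = 1 / (16 * 2 ^ card I)"
  have \<rho>: "0 < \<rho>" by (simp add: \<rho>_def)
  obtain z where z: "z \<in> orthant I" "\<And>e. e \<in> I \<Longrightarrow> a e / 64 \<le> z e" "(ennreal \<rho>)\<^sup>2 * f_max \<le> f z"
    using exists_high_density_corner[of a] a_pos tail_half_sigma by (auto simp: a_def \<rho>_def less_imp_le)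
  have box: "(\<Pi>\<^sub>E e\<in>I. {0..r e}) \<in> sets (\<Pi>\<^sub>M e\<in>I. lborel)" for r :: "'i \<Rightarrow> real"
    using finite_I by (intro sets_PiM_I_finite) auto
  have vol: "emeasure (\<Pi>\<^sub>M e\<in>I. lborel) (\<Pi>\<^sub>E e\<in>I. {0..r e}) = ennreal (\<Prod>e\<in>I. r e)"
    if "\<And>e. e \<in> I \<Longrightarrow> 0 \<le> r e" for r :: "'i \<Rightarrow> real"
    using finite_I that by (subst lborel_PiM.emeasure_PiM) (auto simp: prod_ennreal)
  have f_max_bound: "f_max * ennreal (\<rho>\<^sup>2 * (\<Prod>e\<in>I. a e / 64)) \<le> 1"
  proof -
    have "f_max * ennreal (\<rho>\<^sup>2 * (\<Prod>e\<in>I. a e / 64)) = ((ennreal \<rho>)\<^sup>2 * f_max) * ennreal (\<Prod>e\<in>I. a e / 64)"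
      using \<rho> a_pos by (simp add: ennreal_mult ennreal_power prod_nonneg less_imp_le mult_ac)
    also have "\<dots> \<le> f z * ennreal (\<Prod>e\<in>I. z e)"
      using z a_pos by (intro mult_mono ennreal_leI prod_mono) (auto simp: less_imp_le)
    also have "\<dots> = (\<integral>\<^sup>+x. f z * indicator (\<Pi>\<^sub>E e\<in>I. {0..z e}) x \<partial>(\<Pi>\<^sub>M e\<in>I. lborel))"
      using box[of z] vol[of z] z(1) by (subst nn_integral_cmult_indicator) (auto simp: PiE_iff)
    also have "\<dots> \<le> (\<integral>\<^sup>+x. f x \<partial>(\<Pi>\<^sub>M e\<in>I. lborel))"
    proof (rule nn_integral_mono)
      fix x :: "'i \<Rightarrow> real"
      show "f z * indicator (\<Pi>\<^sub>E e\<in>I. {0..z e}) x \<le> f x"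
        using z(1) f_antimono[of x z] by (auto simp: indicator_def PiE_iff)
    qed
    finally show ?thesis using total by simp
  qed
  have c_pos: "0 < \<rho>\<^sup>2 * (\<Prod>e\<in>I. a e / 64)"
    using \<rho> a_pos by (intro mult_pos_pos prod_pos) auto
  \<comment> \<open>Finiteness of f(0) is a by-product: an infinite value times a positive constant
    could not be at most 1.\<close>
  obtain m where m: "f_max = ennreal m" "0 \<le> m" "m * (\<rho>\<^sup>2 * (\<Prod>e\<in>I. a e / 64)) \<le> 1"
  proof (cases f_max)
    case (real m)
    let ?c = "\<rho>\<^sup>2 * (\<Prod>e\<in>I. a e / 64)"
    have "ennreal (m * ?c) \<le> ennreal 1"
      using f_max_bound real c_pos by (simp only: ennreal_mult less_imp_le ennreal_1)
    then have "m * ?c \<le> 1" by (simp only: ennreal_le_iff zero_le_one)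
    with real that show ?thesis by blast
  next
    case top
    then show ?thesis
      using f_max_bound c_pos by (auto simp: ennreal_top_mult top_unique split: if_splits)
  qed
  let ?X = "{x \<in> rspace I. \<forall>e\<in>I. x e \<le> p}"
  have X: "?X \<in> sets (\<Pi>\<^sub>M e\<in>I. lborel)"
  proof -
    have "?X = (\<Pi>\<^sub>E e\<in>I. {..p})" by (auto simp: PiE_iff extensional_def)
    then show ?thesis using finite_I by (auto intro!: sets_PiM_I_finite)
  qed
  have "emeasure F ?X = (\<integral>\<^sup>+x. f x * indicator ?X x \<partial>(\<Pi>\<^sub>M e\<in>I. lborel))"
    by (rule emeasure_F[OF X])
  also have "\<dots> \<le> (\<integral>\<^sup>+x. f_max * indicator (\<Pi>\<^sub>E e\<in>I. {0..p}) x \<partial>(\<Pi>\<^sub>M e\<in>I. lborel))"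
  proof (rule nn_integral_mono)
    fix x :: "'i \<Rightarrow> real" assume "x \<in> space (\<Pi>\<^sub>M e\<in>I. lborel)"
    then have x: "x \<in> rspace I" by (simp add: space_PiM)
    show "f x * indicator ?X x \<le> f_max * indicator (\<Pi>\<^sub>E e\<in>I. {0..p}) x"
      using f_le_f_max[OF x] f_zero[OF x] x
      by (cases "x \<in> orthant I") (auto simp: indicator_def PiE_iff)
  qed
  also have "\<dots> = ennreal m * ennreal (\<Prod>e\<in>I. p)"
    using box[of "\<lambda>_. p"] vol[of "\<lambda>_. p"] p m by (subst nn_integral_cmult_indicator) auto
  also have "\<dots> = ennreal (m * (\<Prod>e\<in>I. p))" using m p by (simp add: ennreal_mult)
  finally have "prob ?X \<le> m * (\<Prod>e\<in>I. p)"
    using m p by (simp add: emeasure_eq_measure ennreal_le_iff)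
  also have "\<dots> \<le> 1 / (\<rho>\<^sup>2 * (\<Prod>e\<in>I. a e / 64)) * (\<Prod>e\<in>I. p)"
    using m c_pos p by (intro mult_right_mono) (simp_all add: pos_le_divide_eq)
  also have "\<dots> = 256 * (\<Prod>e\<in>I. 512 * p / coord_sigma F e)"
  proof -
    have \<rho>2: "1 / \<rho>\<^sup>2 = 256 * (\<Prod>e\<in>I. 4)"
      by (simp add: \<rho>_def power_divide power_mult_distrib)
        (simp add: power2_eq_square flip: power_mult_distrib)
    have "1 / (\<rho>\<^sup>2 * (\<Prod>e\<in>I. a e / 64)) * (\<Prod>e\<in>I. p) = (1 / \<rho>\<^sup>2) * (1 / (\<Prod>e\<in>I. a e / 64)) * (\<Prod>e\<in>I. p)"
      by simp
    also have "\<dots> = 256 * ((\<Prod>e\<in>I. 4) * (1 / (\<Prod>e\<in>I. a e / 64)) * (\<Prod>e\<in>I. p))"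
      unfolding \<rho>2 by (simp only: mult.assoc)
    also have "(\<Prod>e\<in>I. 4) * (1 / (\<Prod>e\<in>I. a e / 64)) * (\<Prod>e\<in>I. p) = (\<Prod>e\<in>I. 4 * (1 / (a e / 64)) * p)"
      unfolding prod.distrib prod_dividef by simp
    also have "\<dots> = (\<Prod>e\<in>I. 512 * p / coord_sigma F e)"
      by (intro prod.cong) (auto simp: a_def)
    finally show ?thesis .
  qed
  finally show ?thesis .
qed

text \<open>Passing to the marginal on \<open>S\<close> makes the constants exponential in |S|
  instead of |I|; the second moments of the coordinates in \<open>S\<close> are unchanged.\<close>

theorem lower_orthant_prob_le:
  assumes S: "S \<subseteq> I" and p: "0 \<le> p"
  shows "prob {x \<in> rspace I. \<forall>e\<in>S. x e \<le> p} \<le> 256 * (\<Prod>e\<in>S. 512 * p / coord_sigma F e)"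
proof -
  let ?G = "distr F (\<Pi>\<^sub>M e\<in>S. lborel) (\<lambda>x. restrict x S)"
  obtain g where "decreasing_logconcave S g ?G" using marginal[OF S] by auto
  then interpret G: decreasing_logconcave S g ?G .
  have res: "(\<lambda>x. restrict x S) \<in> measurable F (\<Pi>\<^sub>M e\<in>S. lborel)"
    using measurable_restrict_subset[OF S, of "\<lambda>_. lborel :: real measure"] by simp
  have sigma: "coord_sigma ?G e = coord_sigma F e" if e: "e \<in> S" for e
  proof -
    have "(\<integral>x. (x e)\<^sup>2 \<partial>?G) = (\<integral>x. (restrict x S e)\<^sup>2 \<partial>F)"
      using e measurable_component_singleton[of e S "\<lambda>_. lborel :: real measure"]
      by (intro integral_distr[OF res]) measurable
    then show ?thesis using e by (simp add: coord_sigma_def)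
  qed
  let ?X = "{x \<in> rspace S. \<forall>e\<in>S. x e \<le> p}"
  have X: "?X \<in> sets (\<Pi>\<^sub>M e\<in>S. lborel)"
  proof -
    have "?X = (\<Pi>\<^sub>E e\<in>S. {..p})" by (auto simp: PiE_iff extensional_def)
    then show ?thesis using G.finite_I by (auto intro!: sets_PiM_I_finite)
  qed
  have "prob {x \<in> rspace I. \<forall>e\<in>S. x e \<le> p} = prob ((\<lambda>x. restrict x S) -` ?X \<inter> space F)"
    by (intro arg_cong[where f = prob]) auto
  also have "\<dots> = measure ?G ?X" by (rule measure_distr[OF res X, symmetric])
  also have "\<dots> \<le> 256 * (\<Prod>e\<in>S. 512 * p / coord_sigma ?G e)" by (rule G.box_prob_le[OF p])
  also have "\<dots> = 256 * (\<Prod>e\<in>S. 512 * p / coord_sigma F e)" using sigma by simp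
  finally show ?thesis .
qed

end

text \<open>A Bonferroni inequality. The double sum runs over ordered pairs, so each intersection is
  subtracted twice; in the application this affects only the constant of the quadratic term.\<close>

lemma (in prob_space) prob_UN_ge:
  assumes "finite A" "\<And>e. e \<in> A \<Longrightarrow> X e \<in> events"
  shows "(\<Sum>e\<in>A. prob (X e)) - (\<Sum>e\<in>A. \<Sum>e'\<in>A - {e}. prob (X e \<inter> X e')) \<le> prob (\<Union>e\<in>A. X e)"
  using assms
proof (induction A rule: finite_induct)
  case (insert a A)
  let ?U = "\<Union>e\<in>A. X e"
  have U: "?U \<in> events" using insert by (intro sets.finite_UN) auto
  have Xa: "X a \<in> events" using insert by auto
  have "prob (X a \<inter> ?U) = prob (\<Union>e\<in>A. X a \<inter> X e)"
    by (intro arg_cong[where f = prob]) auto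
  also have "\<dots> \<le> (\<Sum>e\<in>A. prob (X a \<inter> X e))"
    using insert by (intro measure_UNION_le) auto
  finally have 1: "prob (X a \<inter> ?U) \<le> (\<Sum>e\<in>A. prob (X a \<inter> X e))" .
  have "(\<Sum>e\<in>A. \<Sum>e'\<in>A - {e}. prob (X e \<inter> X e')) \<le> (\<Sum>e\<in>A. \<Sum>e'\<in>insert a A - {e}. prob (X e \<inter> X e'))"
    using insert.hyps by (intro sum_mono sum_mono2) auto
  moreover have "insert a A - {a} = A" using insert.hyps by auto
  ultimately have 2: "(\<Sum>e\<in>A. prob (X a \<inter> X e)) + (\<Sum>e\<in>A. \<Sum>e'\<in>A - {e}. prob (X e \<inter> X e'))
      \<le> (\<Sum>e\<in>insert a A. \<Sum>e'\<in>insert a A - {e}. prob (X e \<inter> X e'))"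
    using insert.hyps by simp
  have "prob (X a \<union> ?U) = prob (X a) + prob (?U - X a)"
    using finite_measure_Union'[OF Xa U] .
  also have "prob (?U - X a) = prob ?U - prob (X a \<inter> ?U)"
    using finite_measure_Diff'[OF U Xa] by (simp add: Int_commute)
  finally have "prob (\<Union>e\<in>insert a A. X e) = prob (X a) + prob ?U - prob (X a \<inter> ?U)" by simp
  then show ?case using insert 1 2 by simp
qed simp

section \<open>Large values of many coordinates\<close>

context decreasing_logconcave
begin

text \<open>For small t the probability is at most 1 - t|A|/(4\<sigma>) + B t^2. Raising to the
  power 2^j at t = p/2^j preserves the linear term in the exponent and turns the quadratic one into
  B p^2 / 2^j, so \<open>B\<close> may depend on \<open>F\<close> in any way and still drops out in
  the limit.\<close>

theorem upper_orthant_prob_le: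
  assumes A: "A \<subseteq> I" and p: "0 < p" and \<sigma>: "0 < \<sigma>" "\<And>e. e \<in> A \<Longrightarrow> coord_sigma F e \<le> \<sigma>"
  shows "prob {x \<in> rspace I. \<forall>e\<in>A. p \<le> x e} \<le> exp (- (p * card A / (4 * \<sigma>)))"
proof -
  have fin: "finite A" using A finite_I by (rule finite_subset)
  define P where "P = (\<lambda>t. prob {x \<in> rspace I. \<forall>e\<in>A. t \<le> x e})"
  \<comment> \<open>The two-coordinate case of \<open>lower_orthant_prob_le\<close>, summed over
    ordered pairs, with the factor t^2 split off.\<close>
  define B where "B = (\<Sum>e\<in>A. \<Sum>e'\<in>A - {e}. 256 * (512\<^sup>2 / (coord_sigma F e * coord_sigma F e')))"
  have P_le: "P t \<le> exp (- (t * card A / (4 * \<sigma>)) + B * t\<^sup>2)" if t: "0 < t" "t \<le> \<sigma>" for t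
  proof -
    let ?X = "\<lambda>e. {x \<in> rspace I. x e < t}"
    have X: "?X e \<in> events" if "e \<in> A" for e using A that by (intro lower_set_in_events) auto
    have "P t = prob (space F - (\<Union>e\<in>A. ?X e))"
      unfolding P_def by (intro arg_cong[where f = prob]) (auto simp: not_less)
    also have "\<dots> = 1 - prob (\<Union>e\<in>A. ?X e)"
      using X fin by (intro prob_compl sets.finite_UN) auto
    also have "\<dots> \<le> 1 - ((\<Sum>e\<in>A. prob (?X e)) - (\<Sum>e\<in>A. \<Sum>e'\<in>A - {e}. prob (?X e \<inter> ?X e')))"
      using prob_UN_ge[OF fin, of ?X] X by simp
    also have "\<dots> \<le> 1 - (t * card A / (4 * \<sigma>) - B * t\<^sup>2)"
    proof -
      have "(\<Sum>e\<in>A. t / (4 * \<sigma>)) \<le> (\<Sum>e\<in>A. prob (?X e))"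
      proof (rule sum_mono)
        fix e assume "e \<in> A"
        then show "t / (4 * \<sigma>) \<le> prob (?X e)"
          using lower_prob_ge[of e \<sigma> t] A \<sigma> t by (auto simp: lower_prob_def)
      qed
      moreover have "(\<Sum>e\<in>A. \<Sum>e'\<in>A - {e}. prob (?X e \<inter> ?X e')) \<le> B * t\<^sup>2"
        unfolding B_def sum_distrib_right
      proof (intro sum_mono)
        fix e e' assume e: "e \<in> A" "e' \<in> A - {e}"
        have "prob (?X e \<inter> ?X e') \<le> prob {x \<in> rspace I. \<forall>i\<in>{e, e'}. x i \<le> t}"
        proof (rule finite_measure_mono)
          have [measurable]: "e \<in> I" "e' \<in> I" using A e by auto
          have "{x \<in> space F. x e \<le> t \<and> x e' \<le> t} \<in> sets F" by measurable
          then show "{x \<in> rspace I. \<forall>i\<in>{e, e'}. x i \<le> t} \<in> events" by simp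
        qed auto
        also have "\<dots> \<le> 256 * (\<Prod>i\<in>{e, e'}. 512 * t / coord_sigma F i)"
          using A e t by (intro lower_orthant_prob_le) auto
        also have "\<dots> = 256 * (512\<^sup>2 / (coord_sigma F e * coord_sigma F e')) * t\<^sup>2"
        proof -
          have "e \<noteq> e'" using e by auto
          then show ?thesis by (simp add: power2_eq_square)
        qed
        finally show "prob (?X e \<inter> ?X e') \<le> 256 * (512\<^sup>2 / (coord_sigma F e * coord_sigma F e')) * t\<^sup>2" .
      qed
      ultimately show ?thesis by (simp add: algebra_simps)
    qed
    also have "\<dots> \<le> exp (- (t * card A / (4 * \<sigma>)) + B * t\<^sup>2)"
      using exp_ge_add_one_self[of "- (t * card A / (4 * \<sigma>)) + B * t\<^sup>2"] by linarith
    finally show ?thesis .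
  qed
  have "\<forall>\<^sub>F j in sequentially. P p \<le> exp (- (p * card A / (4 * \<sigma>)) + B * p\<^sup>2 * (1/2) ^ j)"
  proof -
    have "(\<lambda>j. p * (1/2) ^ j) \<longlonglongrightarrow> p * 0"
      by (intro tendsto_mult tendsto_const LIMSEQ_power_zero) simp
    then have "\<forall>\<^sub>F j in sequentially. p * (1/2) ^ j < \<sigma>"
      using \<sigma> by (intro order_tendstoD(2)) auto
    then show ?thesis
    proof eventually_elim
      case (elim j)
      define t where "t = p * (1/2) ^ j"
      have t: "0 < t" "t \<le> \<sigma>" "2 ^ j * t = p"
        using p elim by (auto simp: t_def power_one_over)
      have "tail A (2 ^ j * t) \<le> tail A t ^ (2 ^ j)"
        using A t by (intro tail_double_power) auto
      then have "ennreal (P p) \<le> ennreal (P t ^ (2 ^ j))"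
        by (simp add: t tail_def P_def emeasure_eq_measure ennreal_power)
      then have "P p \<le> P t ^ (2 ^ j)" by (simp add: P_def ennreal_le_iff)
      also have "\<dots> \<le> exp (- (t * card A / (4 * \<sigma>)) + B * t\<^sup>2) ^ (2 ^ j)"
        using P_le[OF t(1,2)] by (intro power_mono) (auto simp: P_def)
      also have "\<dots> = exp (- ((2 ^ j * t) * card A / (4 * \<sigma>)) + B * (2 ^ j * t) * t)"
        by (simp flip: exp_of_nat_mult add: algebra_simps power2_eq_square)
      also have "\<dots> = exp (- (p * card A / (4 * \<sigma>)) + B * p\<^sup>2 * (1/2) ^ j)"
        unfolding t(3) by (simp add: t_def power2_eq_square algebra_simps)
      finally show ?case .
    qed
  qed
  moreover have "(\<lambda>j. exp (- (p * card A / (4 * \<sigma>)) + B * p\<^sup>2 * (1/2) ^ j)) \<longlonglongrightarrow>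
      exp (- (p * card A / (4 * \<sigma>)) + B * p\<^sup>2 * 0)"
    by (intro tendsto_intros LIMSEQ_power_zero) simp
  ultimately have "P p \<le> exp (- (p * card A / (4 * \<sigma>)) + B * p\<^sup>2 * 0)"
    by (intro tendsto_lowerbound[where F = sequentially]) auto
  then show ?thesis by (simp add: P_def)
qed

end

section \<open>Perfect matchings\<close>

text \<open>The induction splits on the existence of a proper nonempty subset that satisfies Hall's condition with equality.\<close>

theorem hall_marriage:
  fixes N :: "'a \<Rightarrow> 'b set"
  assumes "finite L" "\<And>x. x \<in> L \<Longrightarrow> finite (N x)"
    and "\<And>S. S \<subseteq> L \<Longrightarrow> card S \<le> card (\<Union>(N ` S))"
  shows "\<exists>m. inj_on m L \<and> (\<forall>x\<in>L. m x \<in> N x)"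
  using assms
proof (induction "card L" arbitrary: L N rule: less_induct)
  case less
  note fin = less.prems(1,2) and hall = less.prems(3)
  have fin_N: "finite (\<Union>(N ` S))" if "S \<subseteq> L" for S
    using fin that finite_subset[OF that] by auto
  show ?case
  proof (cases "\<exists>S. S \<subset> L \<and> S \<noteq> {} \<and> card S = card (\<Union>(N ` S))")
    case True
    then obtain S where S: "S \<subset> L" "S \<noteq> {}" "card S = card (\<Union>(N ` S))" by blast
    have fS: "finite S" using S fin finite_subset by blast
    have "card S < card L" using S fin by (intro psubset_card_mono) auto
    then have "\<exists>m. inj_on m S \<and> (\<forall>x\<in>S. m x \<in> N x)"
      using S fin hall fS by (intro less.hyps) auto
    then obtain m1 where m1: "inj_on m1 S" "\<And>x. x \<in> S \<Longrightarrow> m1 x \<in> N x" by blast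
    \<comment> \<open>The rest keeps Hall's condition after losing all neighbours of
      \<open>S\<close>: the set S \<union> T has at least |S| + |T| neighbours, and exactly |S| of
      them are neighbours of \<open>S\<close>.\<close>
    let ?N = "\<lambda>x. N x - \<Union>(N ` S)"
    have "card (L - S) < card L"
      using S fin by (intro psubset_card_mono) auto
    then have "\<exists>m. inj_on m (L - S) \<and> (\<forall>x\<in>L - S. m x \<in> ?N x)"
    proof (rule less.hyps)
      fix T assume T: "T \<subseteq> L - S"
      have fT: "finite T" using T fin finite_subset by blast
      have "card S + card T = card (S \<union> T)"
        using T fS fT by (intro card_Un_disjoint[symmetric]) auto
      also have "\<dots> \<le> card (\<Union>(N ` (S \<union> T)))"
        using S T by (intro hall) auto
      also have "\<Union>(N ` (S \<union> T)) = \<Union>(N ` S) \<union> \<Union>(?N ` T)" by auto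
      also have "card \<dots> \<le> card (\<Union>(N ` S)) + card (\<Union>(?N ` T))" by (rule card_Un_le)
      finally show "card T \<le> card (\<Union>(?N ` T))" using S by simp
    qed (use fin in auto)
    then obtain m2 where m2: "inj_on m2 (L - S)" "\<And>x. x \<in> L - S \<Longrightarrow> m2 x \<in> ?N x" by blast
    define m where "m = (\<lambda>x. if x \<in> S then m1 x else m2 x)"
    have "inj_on m L"
    proof (rule inj_onI)
      fix x y assume xy: "x \<in> L" "y \<in> L" "m x = m y"
      have cross: "m1 u \<noteq> m2 v" if "u \<in> S" "v \<in> L - S" for u v
        using m1(2)[OF that(1)] m2(2)[OF that(2)] that(1) by auto
      show "x = y"
        using xy cross[of x y] cross[of y x] inj_onD[OF m1(1), of x y] inj_onD[OF m2(1), of x y]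
        by (auto simp: m_def split: if_splits)
    qed
    moreover have "\<forall>x\<in>L. m x \<in> N x" using m1 m2 by (auto simp: m_def)
    ultimately show ?thesis by blast
  next
    case False
    show ?thesis
    proof (cases "L = {}")
      case True
      then show ?thesis by auto
    next
      case L: False
      then obtain a where a: "a \<in> L" by auto
      have "N a \<noteq> {}" using hall[of "{a}"] a by auto
      then obtain b where b: "b \<in> N a" by auto
      \<comment> \<open>Without a tight proper subset, every nonempty T inside
        \<open>L - {a}\<close> has at least |T| + 1 neighbours and can give up
        \<open>b\<close>.\<close>
      let ?N = "\<lambda>x. N x - {b}"
      have "card (L - {a}) < card L" using a fin by (intro psubset_card_mono) auto
      then have "\<exists>m. inj_on m (L - {a}) \<and> (\<forall>x\<in>L - {a}. m x \<in> ?N x)"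
      proof (rule less.hyps)
        fix T assume T: "T \<subseteq> L - {a}"
        show "card T \<le> card (\<Union>(?N ` T))"
        proof (cases "T = {}")
          case False
          have "T \<subset> L" using T a by auto
          then have "card T \<le> card (\<Union>(N ` T))" by (intro hall) auto
          moreover have "card T \<noteq> card (\<Union>(N ` T))"
            using \<open>\<not> (\<exists>S. S \<subset> L \<and> S \<noteq> {} \<and> card S = card (\<Union>(N ` S)))\<close> \<open>T \<subset> L\<close> False by blast
          moreover have "\<Union>(?N ` T) = \<Union>(N ` T) - {b}" by auto
          ultimately show ?thesis
            using fin_N[of T] \<open>T \<subset> L\<close> by (auto simp: card_Diff_singleton_if)
        qed simp
      qed (use fin in auto)
      then obtain m where m: "inj_on m (L - {a})" "\<And>x. x \<in> L - {a} \<Longrightarrow> m x \<in> ?N x" by blast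
      have "inj_on (m(a := b)) L"
        using m by (intro inj_onI) (auto simp: inj_on_def split: if_splits)
      moreover have "\<forall>x\<in>L. (m(a := b)) x \<in> N x" using m b by auto
      ultimately show ?thesis by blast
    qed
  qed
qed

lemma has_perfect_matching_of_bij:
  fixes n :: nat
  assumes V: "V \<union> W = {1..n}" "V \<inter> W = {}" and m: "bij_betw m V W"
    and E: "\<And>v. v \<in> V \<Longrightarrow> {v, m v} \<in> E"
  shows "has_perfect_matching ({1..n}, E)"
  unfolding has_perfect_matching_def perfect_matching_def
proof (intro exI[of _ "(\<lambda>v. {v, m v}) ` V"] conjI)
  have mW: "m v \<in> W" if "v \<in> V" for v using m that by (auto simp: bij_betw_def)
  have inj: "u = v" if "u \<in> V" "v \<in> V" "m u = m v" for u v
    using m that by (auto simp: bij_betw_def dest: inj_onD)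
  show "disjoint ((\<lambda>v. {v, m v}) ` V)"
    unfolding disjoint_def
  proof (intro ballI impI)
    fix e e' assume "e \<in> (\<lambda>v. {v, m v}) ` V" "e' \<in> (\<lambda>v. {v, m v}) ` V" "e \<noteq> e'"
    then obtain u v where uv: "u \<in> V" "v \<in> V" "e = {u, m u}" "e' = {v, m v}" "u \<noteq> v" by auto
    then have "u \<noteq> m v" "v \<noteq> m u" "m u \<noteq> m v" using mW V inj by blast+
    then show "e \<inter> e' = {}" using uv by auto
  qed
  have "\<Union>((\<lambda>v. {v, m v}) ` V) = V \<union> m ` V" by auto
  then show "\<Union>((\<lambda>v. {v, m v}) ` V) = fst ({1..n}, E)" using m V by (simp add: bij_betw_def)
qed (use E in auto)

abbreviation cross_pairs :: "'a set \<Rightarrow> 'a set \<Rightarrow> 'a set set"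
  where "cross_pairs S T \<equiv> (\<lambda>(a, b). {a, b}) ` (S \<times> T)"

lemma card_cross_pairs:
  assumes "S \<inter> T = {}"
  shows "card (cross_pairs S T) = card S * card T"
proof -
  have "inj_on (\<lambda>(a, b). {a, b}) (S \<times> T)"
    using assms by (auto simp: inj_on_def doubleton_eq_iff)
  then show ?thesis by (simp add: card_image card_cartesian_product)
qed

text \<open>A violation of Hall's condition is a set S with at most |S| - 1 neighbours in the other
  half, which leaves at least m + 1 - |S| vertices there not joined to S. T is cut to exactly this
  size so that k = |S| determines both sizes in the union bound.\<close>

lemma no_perfect_matching_obstruction:
  fixes m :: nat
  assumes "\<not> has_perfect_matching ({1..2 * m}, E)"
  shows "\<exists>k\<in>{1..m}. \<exists>S\<in>[{1..m}]\<^bsup>k\<^esup>. \<exists>T\<in>[{m+1..2*m}]\<^bsup>(m + 1 - k)\<^esup>. cross_pairs S T \<inter> E = {}"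
proof -
  let ?V = "{1..m}" and ?W = "{m+1..2*m}"
  let ?N = "\<lambda>v. {w \<in> ?W. {v, w} \<in> E}"
  have "\<not> (\<forall>S. S \<subseteq> ?V \<longrightarrow> card S \<le> card (\<Union>(?N ` S)))"
  proof
    assume "\<forall>S. S \<subseteq> ?V \<longrightarrow> card S \<le> card (\<Union>(?N ` S))"
    then have "\<exists>f. inj_on f ?V \<and> (\<forall>v\<in>?V. f v \<in> ?N v)"
      by (intro hall_marriage) auto
    then obtain f where f: "inj_on f ?V" "\<And>v. v \<in> ?V \<Longrightarrow> f v \<in> ?N v" by blast
    have "f ` ?V = ?W"
    proof (rule card_subset_eq)
      show "f ` ?V \<subseteq> ?W" using f(2) by blast
      show "card (f ` ?V) = card ?W" using f(1) by (simp add: card_image)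
    qed simp
    then have "bij_betw f ?V ?W" using f(1) by (simp add: bij_betw_def)
    then have "has_perfect_matching ({1..2 * m}, E)"
      using f(2) by (intro has_perfect_matching_of_bij) auto
    with assms show False by simp
  qed
  then obtain S where S: "S \<subseteq> ?V" "card (\<Union>(?N ` S)) < card S" by (auto simp: not_le)
  let ?T = "?W - \<Union>(?N ` S)"
  have "card ?T = card ?W - card (\<Union>(?N ` S))"
  proof (rule card_Diff_subset)
    show "\<Union>(?N ` S) \<subseteq> ?W" by blast
    then show "finite (\<Union>(?N ` S))" by (rule finite_subset) simp
  qed
  then have "m + 1 - card S \<le> card ?T" using S by simp
  then obtain T where T: "T \<subseteq> ?T" "card T = m + 1 - card S" "finite T"
    by (rule obtain_subset_with_card_n)
  have "card S \<le> m" using S card_mono[of ?V S] by simp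
  moreover have "finite S" using S finite_subset by blast
  moreover have "{a, b} \<notin> E" if "a \<in> S" "b \<in> T" for a b
    using subsetD[OF T(1) that(2)] that(1) by blast
  then have "cross_pairs S T \<inter> E = {}" by auto
  ultimately show ?thesis
    using S T(2,3) subset_trans[OF T(1) Diff_subset]
    by (intro bexI[of _ "card S"] bexI[of _ S] bexI[of _ T] conjI) (simp_all add: nsets_def Suc_le_eq)
qed

lemma card_perfect_matching:
  assumes M: "M \<subseteq> vertex_pairs (2 * m)" "disjoint M" "\<Union>M = {1..2 * m}"
  shows "card M = m"
proof -
  have two: "finite e" "card e = 2" if "e \<in> M" for e using M that by (auto simp: nsets_def)
  have "card (\<Union>M) = (\<Sum>e\<in>M. card e)"
    using M(2) two by (intro card_Union_disjoint) (auto simp: disjoint_def pairwise_def disjnt_def)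
  also have "\<dots> = card M * 2" using two by simp
  finally show ?thesis using M(3) by simp
qed

section \<open>The random graph\<close>

lemma power_self_le_fact: "real m ^ m \<le> 3 ^ m * fact m"
proof -
  \<comment> \<open>The left side is the term of index m in the exponential series at m.\<close>
  have "real m ^ m /\<^sub>R fact m \<le> exp (real m)"
    using sums_le[OF _ sums_If_finite_set[of "{m}" "\<lambda>k. real m ^ k /\<^sub>R fact k"] exp_converges[of "real m"]]
    by (simp split: if_splits)
  also have "\<dots> = exp 1 ^ m" by (simp flip: exp_of_nat_mult)
  also have "\<dots> \<le> 3 ^ m" using exp_le by (intro power_mono) auto
  finally show ?thesis by (simp add: divide_simps)
qed

text \<open>The number of pairs is at most 2m^2, and dividing by m! \<ge> (m/3)^m leaves the base 2m
  * 3. A base linear in m is what a threshold of order 1/n can absorb.\<close>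

lemma choose_pairs_le:
  assumes "0 < m"
  shows "real ((2 * m) * (2 * m - 1) div 2 choose m) \<le> (6 * real m) ^ m"
proof -
  let ?N = "(2 * m) * (2 * m - 1) div 2"
  have "?N = m * (2 * m - 1)" by simp
  then have N: "?N \<le> 2 * m * m" by (simp add: algebra_simps)
  have "real ((?N choose m) * fact m) \<le> real (?N ^ m)"
    by (intro of_nat_mono binomial_fact_pow)
  also have "\<dots> \<le> real ((2 * m * m) ^ m)"
    by (intro of_nat_mono power_mono N) simp
  also have "\<dots> = real (2 * m) ^ m * real m ^ m" by (simp add: power_mult_distrib)
  also have "\<dots> \<le> real (2 * m) ^ m * (3 ^ m * fact m)"
    by (intro mult_left_mono power_self_le_fact) simp
  also have "\<dots> = (real (2 * m) * 3) ^ m * fact m"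
    by (simp only: power_mult_distrib mult.assoc)
  also have "real (2 * m) * 3 = 6 * real m" by simp
  finally have "real (?N choose m) * fact m \<le> (6 * real m) ^ m * fact m"
    by (simp only: of_nat_mult of_nat_fact)
  then show ?thesis by (rule mult_right_le_imp_le) simp
qed

text \<open>For k \<le> j both binomial coefficients are at most N^k, because (m choose j) = (m
  choose k - 1). Also j \<ge> N/4, so the factor 16 makes the exponential at most N^-(4k), and the
  product is at most N^-(2k).\<close>

lemma choose_mult_exp_le_aux:
  fixes m k j :: nat
  defines "N \<equiv> real (2 * m)"
  assumes kj: "k + j = m + 1" "1 \<le> k" "k \<le> j"
  shows "real (m choose k) * real (m choose j) * exp (- (16 * ln N * (real k * real j) / N)) \<le> 1 / N\<^sup>2"
proof -
  have m: "1 \<le> m" using kj by simp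
  have N: "1 \<le> N" "real m \<le> N" "0 < N" using m by (auto simp: N_def)
  have "m choose k \<le> m ^ k" using kj by (intro binomial_le_pow) auto
  then have "real (m choose k) \<le> real m ^ k" by (simp flip: of_nat_power)
  also have "\<dots> \<le> N ^ k" using N by (intro power_mono) auto
  finally have 1: "real (m choose k) \<le> N ^ k" .
  have "m choose j = m choose (k - 1)"
  proof -
    have "j \<le> m" "m - j = k - 1" using kj by auto
    then show ?thesis using binomial_symmetric[of j m] by simp
  qed
  also have "\<dots> \<le> m ^ (k - 1)" using kj by (intro binomial_le_pow) auto
  finally have "real (m choose j) \<le> real m ^ (k - 1)" by (simp flip: of_nat_power)
  also have "\<dots> \<le> N ^ (k - 1)" using N by (intro power_mono) auto
  also have "\<dots> \<le> N ^ k" using N by (intro power_increasing) auto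
  finally have 2: "real (m choose j) \<le> N ^ k" .
  have "N \<le> 4 * real j" using kj by (simp add: N_def)
  then have "(4 * real k * ln N) * N \<le> (4 * real k * ln N) * (4 * real j)"
    using N by (intro mult_left_mono) auto
  then have "4 * real k * ln N \<le> 16 * ln N * (real k * real j) / N"
    using N by (simp add: pos_le_divide_eq algebra_simps)
  then have "exp (- (16 * ln N * (real k * real j) / N)) \<le> exp (- (4 * real k * ln N))" by simp
  also have "\<dots> = 1 / N ^ (4 * k)"
  proof -
    have "exp (real (4 * k) * ln N) = N ^ (4 * k)"
      using N unfolding exp_of_nat_mult by simp
    then show ?thesis by (simp add: exp_minus inverse_eq_divide)
  qed
  finally have 3: "exp (- (16 * ln N * (real k * real j) / N)) \<le> 1 / N ^ (4 * k)" .
  have "real (m choose k) * real (m choose j) * exp (- (16 * ln N * (real k * real j) / N))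
      \<le> N ^ k * N ^ k * (1 / N ^ (4 * k))"
    using 1 2 3 N by (intro mult_mono) auto
  also have "\<dots> = 1 / N ^ (2 * k)"
  proof -
    have "N ^ (4 * k) = N ^ k * N ^ k * N ^ (2 * k)" by (simp flip: power_add)
    then show ?thesis using N by simp
  qed
  also have "\<dots> \<le> 1 / N\<^sup>2"
    using N kj by (intro divide_left_mono power_increasing) auto
  finally show ?thesis .
qed

text \<open>Exchanging k and m + 1 - k leaves the expression unchanged, so the smaller of the two
  may play the part of k.\<close>

lemma choose_mult_exp_le:
  fixes m k :: nat
  defines "N \<equiv> real (2 * m)"
  assumes k: "k \<in> {1..m}"
  shows "real (m choose k) * real (m choose (m + 1 - k)) * exp (- (16 * ln N * real (k * (m + 1 - k)) / N)) \<le> 1 / N\<^sup>2"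
proof (cases "k \<le> m + 1 - k")
  case True
  then show ?thesis
    using choose_mult_exp_le_aux[of k "m + 1 - k" m] k by (simp add: N_def)
next
  case False
  then show ?thesis
    using choose_mult_exp_le_aux[of "m + 1 - k" k m] k by (simp add: N_def mult_ac)
qed

section \<open>Explicit bounds below and above the threshold\<close>

locale logconcave_random_graph =
  decreasing_logconcave "vertex_pairs (2 * m)" f F for m f F +
  assumes m_pos: "0 < m"
begin

abbreviation "matchable p \<equiv>
  {x \<in> rspace (vertex_pairs (2 * m)). has_perfect_matching (threshold_graph (2 * m) p x)}"

lemma prob_perfect_matching_eq: "prob_perfect_matching (2 * m) F p = prob (matchable p)"
  by (simp add: prob_perfect_matching_def)

lemma lower_box_in_events:
  assumes "S \<subseteq> vertex_pairs (2 * m)"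
  shows "{x \<in> rspace (vertex_pairs (2 * m)). \<forall>e\<in>S. x e \<le> p} \<in> events"
proof -
  have "finite S" using assms finite_I by (rule finite_subset)
  then have "{x \<in> space F. \<forall>e\<in>S. x e \<le> p} \<in> events"
    using assms by (intro sets.sets_Collect_finite_All borel_measurable_le coordinate_measurable) auto
  then show ?thesis by simp
qed

text \<open>A finite union of boxes over the candidate matchings; this form yields measurability,
  monotonicity in p and the covering for the union bound.\<close>

lemma matchable_eq:
  "matchable p = (\<Union>M\<in>{M. M \<subseteq> vertex_pairs (2 * m) \<and> disjoint M \<and> \<Union>M = {1..2 * m}}.
    {x \<in> rspace (vertex_pairs (2 * m)). \<forall>e\<in>M. x e \<le> p})"
  unfolding has_perfect_matching_def perfect_matching_def threshold_graph_def by auto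

lemma matchable_in_events: "matchable p \<in> events"
  unfolding matchable_eq
proof (rule sets.finite_UN)
  show "finite {M. M \<subseteq> vertex_pairs (2 * m) \<and> disjoint M \<and> \<Union>M = {1..2 * m}}"
    using finite_I by (rule finite_subset[rotated, OF finite_Pow_iff[THEN iffD2]]) auto
  fix M assume "M \<in> {M. M \<subseteq> vertex_pairs (2 * m) \<and> disjoint M \<and> \<Union>M = {1..2 * m}}"
  then show "{x \<in> rspace (vertex_pairs (2 * m)). \<forall>e\<in>M. x e \<le> p} \<in> events"
    by (intro lower_box_in_events) blast
qed

lemma matchable_mono:
  assumes "p \<le> q"
  shows "matchable p \<subseteq> matchable q"
proof -
  have "y \<le> q" if "y \<le> p" for y using that assms by linarith
  then show ?thesis unfolding matchable_eq by blast
qed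

lemma vertex_pairs_nonempty: "vertex_pairs (2 * m) \<noteq> {}"
proof -
  have "{1, 2} \<in> vertex_pairs (2 * m)" using m_pos by (auto simp: nsets_def)
  then show ?thesis by blast
qed

lemma sigma_min_le: "e \<in> vertex_pairs (2 * m) \<Longrightarrow> sigma_min (2 * m) F \<le> coord_sigma F e"
  unfolding sigma_min_def using finite_I by (intro Min_le) auto

lemma sigma_max_ge: "e \<in> vertex_pairs (2 * m) \<Longrightarrow> coord_sigma F e \<le> sigma_max (2 * m) F"
  unfolding sigma_max_def using finite_I by (intro Max_ge) auto

lemma sigma_min_pos: "0 < sigma_min (2 * m) F"
  unfolding sigma_min_def using finite_I vertex_pairs_nonempty coord_sigma_pos by (subst Min_gr_iff) auto

lemma sigma_max_pos: "0 < sigma_max (2 * m) F"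
  using vertex_pairs_nonempty coord_sigma_pos sigma_max_ge by (meson all_not_in_conv less_le_trans)

text \<open>With 6144 = 512 * 12, a set of m pairs lies below the threshold with probability at most
  256 / (24m)^m. There are at most (6m)^m such sets, and 6m / 24m = 1/4.\<close>

theorem prob_perfect_matching_le:
  assumes p: "p \<le> 1 / 6144 * sigma_min (2 * m) F / real (2 * m)"
  shows "prob_perfect_matching (2 * m) F p \<le> 256 * (1/2) ^ m"
proof -
  \<comment> \<open>\<open>p\<close> itself may be negative, while the box estimate needs a
    nonnegative threshold.\<close>
  define q where "q = 1 / 6144 * sigma_min (2 * m) F / real (2 * m)"
  have q: "0 \<le> q" using sigma_min_pos by (simp add: q_def)
  let ?box = "\<lambda>S. {x \<in> rspace (vertex_pairs (2 * m)). \<forall>e\<in>S. x e \<le> q}"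
  let ?\<S> = "[vertex_pairs (2 * m)]\<^bsup>m\<^esup>"
  have fin: "finite ?\<S>" by (rule finite_imp_finite_nsets[OF finite_I])
  have box: "?box S \<in> events" if "S \<in> ?\<S>" for S
    using that by (intro lower_box_in_events) (auto simp: nsets_def)
  have "matchable p \<subseteq> matchable q" using p by (intro matchable_mono) (simp add: q_def)
  also have "\<dots> \<subseteq> (\<Union>S\<in>?\<S>. ?box S)"
  proof
    fix x assume "x \<in> matchable q"
    then obtain M where M: "M \<subseteq> vertex_pairs (2 * m)" "disjoint M" "\<Union>M = {1..2 * m}"
      and x: "x \<in> rspace (vertex_pairs (2 * m))" "\<forall>e\<in>M. x e \<le> q"
      unfolding matchable_eq by blast
    have "M \<in> ?\<S>"
      using M card_perfect_matching[OF M] finite_subset[OF M(1) finite_I] by (simp add: nsets_def)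
    then show "x \<in> (\<Union>S\<in>?\<S>. ?box S)" using x by blast
  qed
  finally have "prob (matchable p) \<le> prob (\<Union>S\<in>?\<S>. ?box S)"
    using fin box by (intro finite_measure_mono sets.finite_UN) auto
  also have "\<dots> \<le> (\<Sum>S\<in>?\<S>. prob (?box S))"
    using fin box by (intro measure_UNION_le) auto
  also have "\<dots> \<le> (\<Sum>S\<in>?\<S>. 256 * (1 / (12 * real (2 * m))) ^ m)"
  proof (rule sum_mono)
    fix S assume "S \<in> ?\<S>"
    then have S: "S \<subseteq> vertex_pairs (2 * m)" "card S = m" by (auto simp: nsets_def)
    have "prob (?box S) \<le> 256 * (\<Prod>e\<in>S. 512 * q / coord_sigma F e)"
      by (rule lower_orthant_prob_le[OF S(1) q])
    also have "(\<Prod>e\<in>S. 512 * q / coord_sigma F e) \<le> (\<Prod>e\<in>S. 512 * q / sigma_min (2 * m) F)"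
      using S q sigma_min_le sigma_min_pos coord_sigma_pos
      by (intro prod_mono conjI divide_left_mono mult_pos_pos divide_nonneg_nonneg) (auto intro: less_imp_le)
    also have "\<dots> = (512 * q / sigma_min (2 * m) F) ^ m" using S by simp
    also have "512 * q / sigma_min (2 * m) F = 1 / (12 * real (2 * m))"
      using sigma_min_pos by (simp add: q_def)
    finally show "prob (?box S) \<le> 256 * (1 / (12 * real (2 * m))) ^ m" by simp
  qed
  also have "\<dots> = 256 * (real ((2 * m) * (2 * m - 1) div 2 choose m) * (1 / (12 * real (2 * m))) ^ m)"
    unfolding sum_constant card_nsets[of "vertex_pairs (2 * m)"] card_vertex_pairs
    by (simp only: mult.left_commute)
  also have "\<dots> \<le> 256 * ((6 * real m) ^ m * (1 / (12 * real (2 * m))) ^ m)"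
    using choose_pairs_le[OF m_pos] by (intro mult_left_mono mult_right_mono) auto
  also have "(6 * real m) ^ m * (1 / (12 * real (2 * m))) ^ m = (6 * real m * (1 / (12 * real (2 * m)))) ^ m"
    by (rule power_mult_distrib[symmetric])
  also have "6 * real m * (1 / (12 * real (2 * m))) = 1 / 4"
    using m_pos by simp
  also have "256 * (1/4) ^ m \<le> 256 * (1/2 :: real) ^ m"
    by (intro mult_left_mono power_mono) auto
  finally show ?thesis by (simp add: prob_perfect_matching_eq)
qed

text \<open>A pair (S, T) without edges forces k(m + 1 - k) coordinates to be at least
  \<open>q\<close>, and 64/4 = 16 is the factor in \<open>choose_mult_exp_le\<close>. The m values
  of k together contribute at most m/N^2 \<le> 1/N.\<close>

theorem prob_perfect_matching_ge:
  assumes p: "64 * sigma_max (2 * m) F * ln (real (2 * m)) / real (2 * m) \<le> p"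
  shows "1 - 1 / real (2 * m) \<le> prob_perfect_matching (2 * m) F p"
proof -
  define N where "N = real (2 * m)"
  define \<sigma> where "\<sigma> = sigma_max (2 * m) F"
  define q where "q = 64 * \<sigma> * ln N / N"
  have N: "2 \<le> N" using m_pos by (simp add: N_def)
  have \<sigma>: "0 < \<sigma>" by (simp add: \<sigma>_def sigma_max_pos)
  have q: "0 < q" using N \<sigma> by (simp add: q_def)
  define K where "K = (SIGMA k:{1..m}. [{1..m}]\<^bsup>k\<^esup> \<times> [{m+1..2*m}]\<^bsup>(m + 1 - k)\<^esup>)"
  have fin: "finite K" unfolding K_def by (auto intro: finite_imp_finite_nsets)
  define X where "X = (\<lambda>A. {x \<in> rspace (vertex_pairs (2 * m)). \<forall>e\<in>A. q \<le> x e})"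
  have pairs: "cross_pairs S T \<subseteq> vertex_pairs (2 * m)" "card (cross_pairs S T) = k * (m + 1 - k)"
    if "(k, S, T) \<in> K" for k S T
  proof -
    have ST: "S \<subseteq> {1..m}" "T \<subseteq> {m+1..2*m}" "card S = k" "card T = m + 1 - k"
      using that by (auto simp: K_def nsets_def)
    show "cross_pairs S T \<subseteq> vertex_pairs (2 * m)"
    proof clarify
      fix a b assume "a \<in> S" "b \<in> T"
      then have "a \<in> {1..m}" "b \<in> {m+1..2*m}" using ST by blast+
      then show "{a, b} \<in> vertex_pairs (2 * m)" by (auto simp: nsets_def)
    qed
    have "S \<inter> T = {}" using ST(1,2) by (fastforce simp: subset_eq)
    then show "card (cross_pairs S T) = k * (m + 1 - k)" using ST by (simp add: card_cross_pairs)
  qed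
  have X_sets: "X (cross_pairs S T) \<in> events" if "(k, S, T) \<in> K" for k S T
    unfolding X_def using pairs(1)[OF that] by (intro upper_set_in_events)
  have cover: "space F - matchable p \<subseteq> (\<Union>(k, S, T)\<in>K. X (cross_pairs S T))"
  proof
    fix x assume "x \<in> space F - matchable p"
    then have x: "x \<in> rspace (vertex_pairs (2 * m))"
      "\<not> has_perfect_matching ({1..2 * m}, {e \<in> vertex_pairs (2 * m). x e \<le> p})"
      by (auto simp: threshold_graph_def)
    obtain k S T where kST: "k \<in> {1..m}" "S \<in> [{1..m}]\<^bsup>k\<^esup>" "T \<in> [{m+1..2*m}]\<^bsup>(m + 1 - k)\<^esup>"
      and none: "cross_pairs S T \<inter> {e \<in> vertex_pairs (2 * m). x e \<le> p} = {}"
      using no_perfect_matching_obstruction[OF x(2)] by blast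
    have K: "(k, S, T) \<in> K" using kST by (simp add: K_def)
    have "q \<le> x e" if "e \<in> cross_pairs S T" for e
    proof -
      have "e \<in> vertex_pairs (2 * m)" using pairs(1)[OF K] that by (rule subsetD)
      then have "\<not> x e \<le> p" using none that by blast
      then show ?thesis using p by (simp add: q_def \<sigma>_def N_def)
    qed
    then show "x \<in> (\<Union>(k, S, T)\<in>K. X (cross_pairs S T))"
      using K x(1) unfolding X_def by blast
  qed
  have "prob (space F - matchable p) \<le> prob (\<Union>(k, S, T)\<in>K. X (cross_pairs S T))"
    using cover fin X_sets by (intro finite_measure_mono sets.finite_UN) auto
  also have "\<dots> \<le> (\<Sum>z\<in>K. prob (case z of (k, S, T) \<Rightarrow> X (cross_pairs S T)))"
    using fin X_sets by (intro measure_UNION_le) auto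
  also have "\<dots> \<le> (\<Sum>(k, S, T)\<in>K. exp (- (16 * ln N * real (k * (m + 1 - k)) / N)))"
  proof (rule sum_mono, clarify)
    fix k S T assume z: "(k, S, T) \<in> K"
    have "prob (X (cross_pairs S T)) \<le> exp (- (q * card (cross_pairs S T) / (4 * \<sigma>)))"
      unfolding X_def
      using pairs(1)[OF z] q \<sigma> sigma_max_ge by (intro upper_orthant_prob_le) (auto simp: \<sigma>_def)
    also have "q * card (cross_pairs S T) / (4 * \<sigma>) = 16 * ln N * real (k * (m + 1 - k)) / N"
      unfolding pairs(2)[OF z] using \<sigma> by (simp add: q_def)
    finally show "prob (X (cross_pairs S T)) \<le> exp (- (16 * ln N * real (k * (m + 1 - k)) / N))" .
  qed
  also have "\<dots> = (\<Sum>k\<in>{1..m}. real (m choose k) * real (m choose (m + 1 - k)) *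
      exp (- (16 * ln N * real (k * (m + 1 - k)) / N)))"
    unfolding K_def
    by (subst sum.Sigma[symmetric]) (auto intro: finite_imp_finite_nsets simp: card_cartesian_product)
  also have "\<dots> \<le> (\<Sum>k\<in>{1..m}. 1 / N\<^sup>2)"
    unfolding N_def by (intro sum_mono choose_mult_exp_le)
  also have "\<dots> \<le> 1 / N" using N by (simp add: N_def power2_eq_square divide_simps)
  finally have "prob (space F - matchable p) \<le> 1 / N" .
  then show ?thesis
    using prob_compl[OF matchable_in_events] by (simp add: prob_perfect_matching_eq N_def)
qed

end

text \<open>Writing n = 2m turns limits along even n into ordinary sequence limits, where the
  explicit bounds in m apply.\<close>

lemma eventually_even_at_top:
  "eventually P even_at_top \<longleftrightarrow> (\<forall>\<^sub>F m in sequentially. P (2 * m))"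
proof
  assume "eventually P even_at_top"
  then obtain N where N: "P n" if "N \<le> n" "even n" for n
    by (auto simp: even_at_top_def eventually_inf_principal eventually_at_top_linorder)
  show "\<forall>\<^sub>F m in sequentially. P (2 * m)"
    using eventually_ge_at_top[of N] by eventually_elim (auto intro: N)
next
  assume "\<forall>\<^sub>F m in sequentially. P (2 * m)"
  then obtain N where N: "P (2 * m)" if "N \<le> m" for m
    by (auto simp: eventually_at_top_linorder)
  show "eventually P even_at_top"
    unfolding even_at_top_def eventually_inf_principal
    using eventually_ge_at_top[of "2 * N"] by eventually_elim (auto elim!: evenE intro: N)
qed

lemma tendsto_even_at_top:
  "(g \<longlongrightarrow> l) even_at_top \<longleftrightarrow> (\<lambda>m. g (2 * m)) \<longlonglongrightarrow> l"
  by (simp add: tendsto_def eventually_even_at_top)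

theorem theorem2p3:
  shows "\<exists>c3 c4 :: real. 0 < c3 \<and> c3 < c4 \<and>
    (\<forall>(F :: nat \<Rightarrow> (nat set \<Rightarrow> real) measure) (p :: nat \<Rightarrow> real).
      (\<forall>n. down_monotone_logconcave_distribution (vertex_pairs n) (F n)) \<longrightarrow>
      ((\<forall>\<^sub>F n in even_at_top. p n < c3 * sigma_min n (F n) / real n) \<longrightarrow>
        ((\<lambda>n. prob_perfect_matching n (F n) (p n)) \<longlongrightarrow> 0) even_at_top) \<and>
      ((\<forall>\<^sub>F n in even_at_top. p n > c4 * sigma_max n (F n) * ln (real n) / real n) \<longrightarrow>
        ((\<lambda>n. prob_perfect_matching n (F n) (p n)) \<longlongrightarrow> 1) even_at_top))"
proof (rule exI[of _ "1 / 6144"], rule exI[of _ 64], intro conjI allI impI)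
  fix F :: "nat \<Rightarrow> (nat set \<Rightarrow> real) measure" and p :: "nat \<Rightarrow> real"
  assume F: "\<forall>n. down_monotone_logconcave_distribution (vertex_pairs n) (F n)"
  \<comment> \<open>For m = 0 there are no pairs, and \<open>sigma_min\<close> and
    \<open>sigma_max\<close> would be extrema of the empty set.\<close>
  have graph: "\<exists>f. logconcave_random_graph m f (F (2 * m))" if "0 < m" for m
  proof -
    have "finite (vertex_pairs (2 * m))" by (intro finite_imp_finite_nsets) simp
    with F obtain f where "decreasing_logconcave (vertex_pairs (2 * m)) f (F (2 * m))"
      using down_monotone_logconcave_distribution_imp by blast
    then show ?thesis
      using that by (auto simp: logconcave_random_graph_def logconcave_random_graph_axioms_def)
  qed
  show "((\<lambda>n. prob_perfect_matching n (F n) (p n)) \<longlongrightarrow> 0) even_at_top"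
    if p: "\<forall>\<^sub>F n in even_at_top. p n < 1 / 6144 * sigma_min n (F n) / real n"
    unfolding tendsto_even_at_top
  proof (rule tendsto_sandwich[OF _ _ tendsto_const])
    show "\<forall>\<^sub>F m in sequentially. 0 \<le> prob_perfect_matching (2 * m) (F (2 * m)) (p (2 * m))"
      by (simp add: prob_perfect_matching_def)
    show "\<forall>\<^sub>F m in sequentially. prob_perfect_matching (2 * m) (F (2 * m)) (p (2 * m)) \<le> 256 * (1/2) ^ m"
      using p[unfolded eventually_even_at_top] eventually_gt_at_top[of 0]
    proof eventually_elim
      case (elim m)
      with graph obtain f where "logconcave_random_graph m f (F (2 * m))" by blast
      then show ?case
        using elim by (intro logconcave_random_graph.prob_perfect_matching_le) auto
    qed
    show "(\<lambda>m. 256 * (1/2::real) ^ m) \<longlonglongrightarrow> 0"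
      by (intro tendsto_mult_right_zero LIMSEQ_power_zero) simp
  qed
  show "((\<lambda>n. prob_perfect_matching n (F n) (p n)) \<longlongrightarrow> 1) even_at_top"
    if p: "\<forall>\<^sub>F n in even_at_top. p n > 64 * sigma_max n (F n) * ln (real n) / real n"
    unfolding tendsto_even_at_top
  proof (rule tendsto_sandwich[OF _ _ _ tendsto_const])
    show "\<forall>\<^sub>F m in sequentially. 1 - 1 / real (2 * m) \<le> prob_perfect_matching (2 * m) (F (2 * m)) (p (2 * m))"
      using p[unfolded eventually_even_at_top] eventually_gt_at_top[of 0]
    proof eventually_elim
      case (elim m)
      with graph obtain f where "logconcave_random_graph m f (F (2 * m))" by blast
      then show ?case
        using elim by (intro logconcave_random_graph.prob_perfect_matching_ge) auto
    qed
    show "\<forall>\<^sub>F m in sequentially. prob_perfect_matching (2 * m) (F (2 * m)) (p (2 * m)) \<le> 1"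
      using F by (auto simp: down_monotone_logconcave_distribution_def prob_perfect_matching_def
          intro!: always_eventually prob_space.prob_le_1)
    have "strict_mono ((*) (2::nat))" by (simp add: strict_mono_def)
    from LIMSEQ_subseq_LIMSEQ[OF lim_1_over_n[where 'a = real] this]
    have "(\<lambda>m. 1 / real (2 * m)) \<longlonglongrightarrow> 0" by (simp add: o_def)
    from tendsto_diff[OF tendsto_const this, of 1]
    show "(\<lambda>m. 1 - 1 / real (2 * m)) \<longlonglongrightarrow> 1" by simp
  qed
qed auto

end
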